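(* (1) $\mathsf{SRT}^2_2\le_\mathrm{W}\mathsf{LPO}\ast\mathsf{wRSgr}$. (2) $\mathsf{SRT}^2_2\le_\mathrm{W}(\mathsf{LPO}\times\mathsf{LPO})\ast\mathsf{wRSg}$.
   Context: Problems are multi-valued partial functions $\subseteq\omega^\omega\rightrightarrows\omega^\omega$ with standard codings. $\mathcal{F}\le_\mathrm{W}\mathcal{G}$ if there are Turing functionals $\Phi,\Psi$ with $\Phi(f)\in\mathrm{dom}(\mathcal{G})$ for all $f\in\mathrm{dom}(\mathcal{F})$ and $\Psi(\langle f,g\rangle)\in\mathcal{F}(f)$ for all $f\in\mathrm{dom}(\mathcal F)$, $g\in\mathcal{G}(\Phi(f))$. The compositional product $\mathcal F\ast\mathcal G$ is (up to Weihrauch equivalence) the $\le_\mathrm{W}$-maximum of the set of compositions $\mathcal F_0\circ\mathcal G_0$ with $\mathcal F_0\le_\mathrm W\mathcal F$, $\mathcal G_0\le_\mathrm W\mathcal G$ composable; in particular $\mathcal H\le_\mathrm W\mathcal F\ast\mathcal G$ holds if there are Turing functionals $\Phi,\Theta,\Psi$ such that for every $p\in\mathrm{dom}(\mathcal H)$: $\Phi(p)\in\mathrm{dom}(\mathcal G)$; $\Theta(\langle p,q\rangle)\in\mathrm{dom}(\mathcal F)$ for all $q\in\mathcal G(\Phi(p))$; and $\Psi(\langle\langle p,q\rangle,r\rangle)\in\mathcal H(p)$ for all such $q$ and all $r\in\mathcal F(\Theta(\langle p,q\rangle))$. $\mathcal F\times\mathcal G$ takes pairs of inputs and returns pairs of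 solutions. $\mathsf{LPO}$: input $p\in\omega^\omega$; output $0$ if $p(n)=0$ for some $n$, and $1$ otherwise. $\mathsf{SRT}^2_2$: input a stable $c\colon[\omega]^2\to\{0,1\}$ ($\lim_sc(n,s)$ exists for each $n$); output an infinite $H$ with $c$ constant on $[H]^2$. Graphs $G=(V,E)$ are simple with $V\subseteq\omega$ infinite, $E\subseteq[V]^2$; $N(v)=\{y:(v,y)\in E\}$. $\mathsf{wRSg}$: input an infinite graph; output an infinite $H\subseteq V$ with, for all $v\in H$, $|H\cap N(v)|=\omega$ or $|H\cap N(v)|\le1$. $\mathsf{wRSgr}$: same input; output an infinite $H\subseteq V$ with, for all $v\in H$, $|H\cap N(v)|=\omega$ or $|H\cap N(v)|=0$. *)

theory Defs
  imports "HOL-Library.Nat_Bijection" "HOL-Library.FuncSet" "HOL-Library.Ramsey"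
begin

section \<open>Turing functionals\<close>

type_synonym baire = "nat \<Rightarrow> nat"

text \<open>Kleene's partial recursive functions relative to an oracle \<open>f\<close>, in unary form: several
  arguments are packed into one by the Cantor pairing \<open>prod_encode\<close>.\<close>

datatype prog =
    PZero | PSucc | PFst | PSnd | PQuery
  | PPair prog prog | PComp prog prog | PRec prog prog | PMu prog

inductive eval :: "baire \<Rightarrow> prog \<Rightarrow> nat \<Rightarrow> nat \<Rightarrow> bool" for f :: baire where
  Zero: "eval f PZero n 0"
| Succ: "eval f PSucc n (Suc n)"
| Fst: "eval f PFst n (fst (prod_decode n))"
| Snd: "eval f PSnd n (snd (prod_decode n))"
| Query: "eval f PQuery n (f n)"
| Pair: "\<lbrakk>eval f a n x; eval f b n y\<rbrakk> \<Longrightarrow> eval f (PPair a b) n (prod_encode (x, y))"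
| Comp: "\<lbrakk>eval f b n x; eval f a x y\<rbrakk> \<Longrightarrow> eval f (PComp a b) n y"
| Rec_0: "eval f a x y \<Longrightarrow> eval f (PRec a b) (prod_encode (x, 0)) y"
| Rec_Suc: "\<lbrakk>eval f (PRec a b) (prod_encode (x, m)) r;
      eval f b (prod_encode (x, prod_encode (m, r))) y\<rbrakk>
    \<Longrightarrow> eval f (PRec a b) (prod_encode (x, Suc m)) y"
| Mu: "\<lbrakk>eval f a (prod_encode (n, k)) 0;
      \<And>i. i < k \<Longrightarrow> \<exists>w. eval f a (prod_encode (n, i)) (Suc w)\<rbrakk>
    \<Longrightarrow> eval f (PMu a) n k"

definition computes :: "prog \<Rightarrow> baire \<Rightarrow> baire \<Rightarrow> bool" where
  "computes e f g \<longleftrightarrow> (\<forall>n. eval f e n (g n))"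

definition functional :: "prog \<Rightarrow> baire \<Rightarrow> baire option" where
  "functional e f = (if \<exists>g. computes e f g then Some (THE g. computes e f g) else None)"

definition turing_functional :: "(baire \<Rightarrow> baire option) \<Rightarrow> bool" where
  "turing_functional \<Phi> \<longleftrightarrow> (\<exists>e. \<Phi> = functional e)"


section \<open>Problems and Weihrauch reducibility\<close>

definition pair_fun :: "baire \<Rightarrow> baire \<Rightarrow> baire" (\<open>\<langle>_,/ _\<rangle>\<close>) where
  "\<langle>f, g\<rangle> = (\<lambda>n. if even n then f (n div 2) else g (n div 2))"

type_synonym problem = "baire \<Rightarrow> baire set"

definition pdom :: "problem \<Rightarrow> baire set" where
  "pdom F = {p. F p \<noteq> {}}"

definition weihrauch_le :: "problem \<Rightarrow> problem \<Rightarrow> bool" (infix \<open>\<le>\<^sub>W\<close> 50) where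
  "F \<le>\<^sub>W G \<longleftrightarrow>
    (\<exists>\<Phi> \<Psi>. turing_functional \<Phi> \<and> turing_functional \<Psi> \<and>
      (\<forall>f \<in> pdom F. \<exists>x \<in> pdom G. \<Phi> f = Some x \<and>
        (\<forall>g \<in> G x. \<exists>y \<in> F f. \<Psi> \<langle>f, g\<rangle> = Some y)))"

definition prob_times :: "problem \<Rightarrow> problem \<Rightarrow> problem" (infixr \<open>\<times>\<^sub>W\<close> 80) where
  "F \<times>\<^sub>W G = (\<lambda>p. {\<langle>u, v\<rangle> | u v f g. p = \<langle>f, g\<rangle> \<and> u \<in> F f \<and> v \<in> G g})"

definition composable :: "problem \<Rightarrow> problem \<Rightarrow> bool" where
  "composable F G \<longleftrightarrow> (\<forall>p. G p \<subseteq> pdom F)"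

definition prob_comp :: "problem \<Rightarrow> problem \<Rightarrow> problem" (infixr \<open>\<circ>\<^sub>W\<close> 75) where
  "F \<circ>\<^sub>W G = (\<lambda>p. \<Union>q \<in> G p. F q)"

definition compositions :: "problem \<Rightarrow> problem \<Rightarrow> problem set" where
  "compositions F G = {F0 \<circ>\<^sub>W G0 | F0 G0. F0 \<le>\<^sub>W F \<and> G0 \<le>\<^sub>W G \<and> composable F0 G0}"

definition is_comp_prod :: "problem \<Rightarrow> problem \<Rightarrow> problem \<Rightarrow> bool" where
  "is_comp_prod F G P \<longleftrightarrow> P \<in> compositions F G \<and> (\<forall>Q \<in> compositions F G. Q \<le>\<^sub>W P)"

text \<open>A maximum is determined only up to Weihrauch equivalence; we choose a representative.
  Existence is \<open>comp_prod_is_maximum\<close> at the end of this theory.\<close>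

definition comp_prod :: "problem \<Rightarrow> problem \<Rightarrow> problem" (infixr \<open>\<star>\<^sub>W\<close> 75) where
  "F \<star>\<^sub>W G = (SOME P. is_comp_prod F G P)"


section \<open>The particular problems\<close>

definition char_fun :: "nat set \<Rightarrow> baire" where
  "char_fun A = (\<lambda>n. if n \<in> A then 1 else 0)"

text \<open>A natural number \<open>k\<close> is named by every \<open>q\<close> with \<open>q 0 = k\<close>.\<close>

definition LPO :: problem where
  "LPO p = {q. q 0 = (if \<exists>n. p n = 0 then 0 else 1)}"

text \<open>A colouring of pairs is named by a function giving the colour of \<open>{n, s}\<close>, \<open>n < s\<close>,
  at position \<open>prod_encode (n, s)\<close>; the values at other positions are irrelevant.\<close>

definition names_colouring :: "baire \<Rightarrow> (nat set \<Rightarrow> nat) \<Rightarrow> bool" where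
  "names_colouring p c \<longleftrightarrow>
    c \<in> [UNIV]\<^bsup>2\<^esup> \<rightarrow> {0, 1} \<and> (\<forall>n s. n < s \<longrightarrow> p (prod_encode (n, s)) = c {n, s})"

definition stable_colouring :: "(nat set \<Rightarrow> nat) \<Rightarrow> bool" where
  "stable_colouring c \<longleftrightarrow> (\<forall>n. \<exists>i. \<forall>\<^sub>F s in sequentially. c {n, s} = i)"

definition SRT22 :: problem where
  "SRT22 p = {char_fun H | H c. names_colouring p c \<and> stable_colouring c \<and>
     infinite H \<and> (\<exists>i. \<forall>e \<in> [H]\<^bsup>2\<^esup>. c e = i)}"

definition inf_graph :: "nat set \<Rightarrow> nat set set \<Rightarrow> bool" where
  "inf_graph V E \<longleftrightarrow> infinite V \<and> E \<subseteq> [V]\<^bsup>2\<^esup>"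

definition nbhd :: "nat set set \<Rightarrow> nat \<Rightarrow> nat set" where
  "nbhd E v = {y. {v, y} \<in> E}"

definition graph_name :: "nat set \<Rightarrow> nat set set \<Rightarrow> baire" where
  "graph_name V E = \<langle>char_fun V, char_fun {prod_encode (u, v) | u v. {u, v} \<in> E}\<rangle>"

definition wRSg :: problem where
  "wRSg p = {char_fun H | H V E. inf_graph V E \<and> p = graph_name V E \<and> H \<subseteq> V \<and> infinite H \<and>
     (\<forall>v \<in> H. infinite (H \<inter> nbhd E v) \<or> finite (H \<inter> nbhd E v) \<and> card (H \<inter> nbhd E v) \<le> 1)}"

definition wRSgr :: problem where
  "wRSgr p = {char_fun H | H V E. inf_graph V E \<and> p = graph_name V E \<and> H \<subseteq> V \<and> infinite H \<and>
     (\<forall>v \<in> H. infinite (H \<inter> nbhd E v) \<or> H \<inter> nbhd E v = {})}"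


section \<open>Every instance has a solution\<close>

lemma pdom_LPO: "pdom LPO = UNIV"
proof -
  have "(\<lambda>_. if \<exists>n. p n = 0 then 0 else 1) \<in> LPO p" for p by (simp add: LPO_def)
  then show ?thesis unfolding pdom_def by blast
qed

lemma pdom_SRT22: "pdom SRT22 = {p. \<exists>c. names_colouring p c \<and> stable_colouring c}"
proof -
  have "\<exists>H. infinite H \<and> (\<exists>i. \<forall>e \<in> [H]\<^bsup>2\<^esup>. c e = i)" if "names_colouring p c" for p c
  proof -
    have "\<forall>x\<in>UNIV. \<forall>y\<in>UNIV. x \<noteq> y \<longrightarrow> c {x, y} < 2"
    proof (intro ballI impI)
      fix x y :: nat assume "x \<noteq> y"
      then have "{x, y} \<in> [UNIV]\<^bsup>2\<^esup>" by (simp add: nsets_def)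
      then have "c {x, y} \<in> {0, 1}" using that unfolding names_colouring_def by blast
      then show "c {x, y} < 2" by auto
    qed
    from Ramsey2[OF infinite_UNIV_nat this] obtain Y t where
      Y: "infinite Y" "\<forall>x\<in>Y. \<forall>y\<in>Y. x \<noteq> y \<longrightarrow> c {x, y} = t" by blast
    have "c e = t" if e: "e \<in> [Y]\<^bsup>2\<^esup>" for e
    proof -
      from e obtain x y where "e = {x, y}" "x \<noteq> y" "x \<in> Y" "y \<in> Y"
        unfolding nsets_def card_2_iff by blast
      then show ?thesis using Y(2) by blast
    qed
    with Y(1) show ?thesis by blast
  qed
  note solution = this
  show ?thesis
  proof (intro set_eqI iffI)
    fix p assume "p \<in> pdom SRT22"
    then show "p \<in> {p. \<exists>c. names_colouring p c \<and> stable_colouring c}"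
      by (auto simp: pdom_def SRT22_def)
  next
    fix p assume "p \<in> {p. \<exists>c. names_colouring p c \<and> stable_colouring c}"
    then obtain c where c: "names_colouring p c" "stable_colouring c" by blast
    obtain H where "infinite H" "\<exists>i. \<forall>e \<in> [H]\<^bsup>2\<^esup>. c e = i" using solution[OF c(1)] by blast
    with c have "char_fun H \<in> SRT22 p" unfolding SRT22_def by blast
    then show "p \<in> pdom SRT22" unfolding pdom_def by blast
  qed
qed

lemma wRSgr_subset_wRSg: "wRSgr p \<subseteq> wRSg p"
proof
  fix q assume "q \<in> wRSgr p"
  then obtain H V E where "q = char_fun H" "inf_graph V E" "p = graph_name V E" "H \<subseteq> V" "infinite H"
    and H: "\<forall>v \<in> H. infinite (H \<inter> nbhd E v) \<or> H \<inter> nbhd E v = {}"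
    unfolding wRSgr_def by blast
  moreover have "\<forall>v \<in> H. infinite (H \<inter> nbhd E v) \<or>
      finite (H \<inter> nbhd E v) \<and> card (H \<inter> nbhd E v) \<le> 1"
    using H by (metis card.empty finite.emptyI zero_le)
  ultimately show "q \<in> wRSg p" unfolding wRSg_def by blast
qed

lemma pdom_wRSgr: "pdom wRSgr = {graph_name V E | V E. inf_graph V E}"
proof -
  have "\<exists>H. H \<subseteq> V \<and> infinite H \<and> (\<forall>v \<in> H. infinite (H \<inter> nbhd E v) \<or> H \<inter> nbhd E v = {})"
    if G: "inf_graph V E" for V E
  proof -
    have "infinite V" using G by (simp add: inf_graph_def)
    moreover have "\<forall>x\<in>V. \<forall>y\<in>V. x \<noteq> y \<longrightarrow> (if {x, y} \<in> E then 1 else 0) < (2::nat)" by simp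
    ultimately have "\<exists>Y t. Y \<subseteq> V \<and> infinite Y \<and> t < (2::nat) \<and>
        (\<forall>x\<in>Y. \<forall>y\<in>Y. x \<noteq> y \<longrightarrow> (if {x, y} \<in> E then 1 else 0) = t)"
      by (rule Ramsey2)
    then obtain Y and t :: nat where
      Y: "Y \<subseteq> V" "infinite Y" "\<forall>x\<in>Y. \<forall>y\<in>Y. x \<noteq> y \<longrightarrow> (if {x, y} \<in> E then 1 else 0) = t"
      by blast
    have "infinite (Y \<inter> nbhd E v) \<or> Y \<inter> nbhd E v = {}" if v: "v \<in> Y" for v
    proof (cases "t = 1")
      case True
      have "{v, y} \<in> E" if "y \<in> Y - {v}" for y
      proof (rule ccontr)
        assume "{v, y} \<notin> E"
        moreover have "(if {v, y} \<in> E then 1 else 0) = t" using Y(3)[rule_format, OF v, of y] that by simp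
        ultimately show False using True by simp
      qed
      then have "Y - {v} \<subseteq> Y \<inter> nbhd E v" unfolding nbhd_def by blast
      moreover have "infinite (Y - {v})" using Y(2) by simp
      ultimately show ?thesis by (meson finite_subset)
    next
      case False
      have "{v, v} \<notin> E"
      proof
        assume "{v, v} \<in> E"
        then have "{v} \<in> [V]\<^bsup>2\<^esup>" using G unfolding inf_graph_def by auto
        then show False by (simp add: nsets_def)
      qed
      moreover have "{v, y} \<notin> E" if "y \<in> Y" "y \<noteq> v" for y
      proof
        assume "{v, y} \<in> E"
        moreover have "(if {v, y} \<in> E then 1 else 0) = t" using Y(3)[rule_format, OF v, of y] that by simp
        ultimately show False using False by simp
      qed
      ultimately have "Y \<inter> nbhd E v = {}" unfolding nbhd_def by blast
      then show ?thesis ..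
    qed
    with Y(1,2) show ?thesis by blast
  qed
  note solution = this
  show ?thesis
  proof (intro set_eqI iffI)
    fix p assume "p \<in> pdom wRSgr"
    then show "p \<in> {graph_name V E | V E. inf_graph V E}" by (auto simp: pdom_def wRSgr_def)
  next
    fix p assume "p \<in> {graph_name V E | V E. inf_graph V E}"
    then obtain V E where G: "p = graph_name V E" "inf_graph V E" by blast
    obtain H where "H \<subseteq> V" "infinite H"
      "\<forall>v \<in> H. infinite (H \<inter> nbhd E v) \<or> H \<inter> nbhd E v = {}" using solution[OF G(2)] by blast
    with G have "char_fun H \<in> wRSgr p" unfolding wRSgr_def by blast
    then show "p \<in> pdom wRSgr" unfolding pdom_def by blast
  qed
qed

lemma pdom_wRSg: "pdom wRSg = {graph_name V E | V E. inf_graph V E}"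
proof
  show "pdom wRSg \<subseteq> {graph_name V E | V E. inf_graph V E}"
    by (auto simp: pdom_def wRSg_def)
  show "{graph_name V E | V E. inf_graph V E} \<subseteq> pdom wRSg"
    using wRSgr_subset_wRSg unfolding pdom_wRSgr[symmetric] pdom_def by blast
qed


section \<open>Basic facts on Turing functionals\<close>

inductive_cases eval_elims:
  "eval f PZero n y" "eval f PSucc n y" "eval f PFst n y" "eval f PSnd n y" "eval f PQuery n y"
  "eval f (PPair a b) n y" "eval f (PComp a b) n y" "eval f (PMu a) n y"
inductive_cases eval_RecE: "eval f (PRec a b) n y"

lemma eval_det: "eval f e n y \<Longrightarrow> eval f e n z \<Longrightarrow> y = z"
proof (induction arbitrary: z rule: eval.induct)
  case (Pair a n x b y)
  from Pair.prems show ?case by (rule eval_elims) (use Pair.IH in simp)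
next
  case (Comp b n x a y)
  from Comp.prems show ?case by (rule eval_elims) (use Comp.IH in simp)
next
  case (Rec_0 a x y b)
  from Rec_0.prems show ?case by (rule eval_RecE) (use Rec_0.IH in simp_all)
next
  case (Rec_Suc a b x m r y)
  from Rec_Suc.prems show ?case by (rule eval_RecE) (use Rec_Suc.IH in simp_all)
next
  case (Mu a n k)
  from Mu.prems have z: "eval f a (prod_encode (n, z)) 0"
    "\<And>i. i < z \<Longrightarrow> \<exists>w. eval f a (prod_encode (n, i)) (Suc w)" by (auto elim: eval_elims)
  show ?case
  proof (rule linorder_cases[of k z])
    assume "k < z"
    then obtain w where "eval f a (prod_encode (n, k)) (Suc w)" using z(2) by blast
    from Mu.IH(1)[OF this] show ?thesis by simp
  next
    assume "z < k"
    then obtain w where "\<And>v. eval f a (prod_encode (n, z)) v \<Longrightarrow> Suc w = v"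
      using Mu.IH(2) by blast
    from this[OF z(1)] show ?thesis by simp
  qed
qed (auto elim: eval_elims)

lemma computes_det: "computes e f g \<Longrightarrow> computes e f h \<Longrightarrow> g = h"
  unfolding computes_def using eval_det by blast

lemma functional_eq_Some: "functional e f = Some g \<longleftrightarrow> computes e f g"
proof -
  have "(THE h. computes e f h) = h" if "computes e f h" for h
    using that computes_det[OF _ that] by blast
  then show ?thesis unfolding functional_def by (metis option.distinct(1) option.inject)
qed

lemma weihrauch_leI:
  assumes "\<And>f. f \<in> pdom F \<Longrightarrow> \<exists>x \<in> pdom G. computes d f x \<and>
    (\<forall>g \<in> G x. \<exists>y \<in> F f. computes e \<langle>f, g\<rangle> y)"
  shows "F \<le>\<^sub>W G"
  unfolding weihrauch_le_def turing_functional_def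
  by (rule exI[of _ "functional d"], rule exI[of _ "functional e"])
    (use assms in \<open>auto simp: functional_eq_Some\<close>)

lemma weihrauch_leE:
  assumes "F \<le>\<^sub>W G"
  obtains d e where "\<And>f. f \<in> pdom F \<Longrightarrow> \<exists>x \<in> pdom G. computes d f x \<and>
    (\<forall>g \<in> G x. \<exists>y \<in> F f. computes e \<langle>f, g\<rangle> y)"
proof -
  from assms obtain d e where "\<forall>f \<in> pdom F. \<exists>x \<in> pdom G. functional d f = Some x \<and>
    (\<forall>g \<in> G x. \<exists>y \<in> F f. functional e \<langle>f, g\<rangle> = Some y)"
    unfolding weihrauch_le_def turing_functional_def by auto
  then show thesis unfolding functional_eq_Some by (intro that) blast
qed

fun psubst :: "prog \<Rightarrow> prog \<Rightarrow> prog" where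
  "psubst d PQuery = d"
| "psubst d (PPair a b) = PPair (psubst d a) (psubst d b)"
| "psubst d (PComp a b) = PComp (psubst d a) (psubst d b)"
| "psubst d (PRec a b) = PRec (psubst d a) (psubst d b)"
| "psubst d (PMu a) = PMu (psubst d a)"
| "psubst d e = e"

lemma eval_psubst: "eval g e n y \<Longrightarrow> computes d f g \<Longrightarrow> eval f (psubst d e) n y"
  by (induction rule: eval.induct)
    (auto intro: eval.intros simp: computes_def, (rule eval.Mu; blast)+)

lemma computes_psubst: "computes d f g \<Longrightarrow> computes e g h \<Longrightarrow> computes (psubst d e) f h"
  unfolding computes_def[of _ _ h] by (auto intro: eval_psubst)

text \<open>Uniform computability of total operations, and its closure properties.\<close>

definition recf :: "(baire \<Rightarrow> nat \<Rightarrow> nat) \<Rightarrow> bool" where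
  "recf F \<longleftrightarrow> (\<exists>e. \<forall>f n. eval f e n (F f n))"

lemma recf_comp: "recf G \<Longrightarrow> recf F \<Longrightarrow> recf (\<lambda>f n. G f (F f n))"
  unfolding recf_def using eval.Comp by blast

lemma recf_pair: "recf F \<Longrightarrow> recf G \<Longrightarrow> recf (\<lambda>f n. prod_encode (F f n, G f n))"
  unfolding recf_def using eval.Pair by blast

lemma recf_fst: "recf F \<Longrightarrow> recf (\<lambda>f n. fst (prod_decode (F f n)))"
  by (rule recf_comp[of "\<lambda>f n. fst (prod_decode n)"]) (auto simp: recf_def intro: eval.intros)

lemma recf_snd: "recf F \<Longrightarrow> recf (\<lambda>f n. snd (prod_decode (F f n)))"
  by (rule recf_comp[of "\<lambda>f n. snd (prod_decode n)"]) (auto simp: recf_def intro: eval.intros)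

lemma recf_query: "recf F \<Longrightarrow> recf (\<lambda>f n. f (F f n))"
  by (rule recf_comp[of "\<lambda>f n. f n"]) (auto simp: recf_def intro: eval.intros)

lemma recf_Suc: "recf F \<Longrightarrow> recf (\<lambda>f n. Suc (F f n))"
  by (rule recf_comp[of "\<lambda>f n. Suc n"]) (auto simp: recf_def intro: eval.intros)

lemma recf_const: "recf (\<lambda>f n. k)"
proof (induction k)
  case 0
  show ?case by (auto simp: recf_def intro: eval.intros)
next
  case (Suc k)
  then show ?case by (rule recf_Suc)
qed

lemma recf_id: "recf (\<lambda>f n. n)"
proof -
  have "eval f (PPair PFst PSnd) n n" for f n
    using eval.Pair[OF eval.Fst eval.Snd, of f n] by simp
  then show ?thesis unfolding recf_def by blast
qed

lemma recf_rec:
  assumes "recf A" "recf B" "recf X" "recf N"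
  shows "recf (\<lambda>f n. rec_nat (A f (X f n))
    (\<lambda>m r. B f (prod_encode (X f n, prod_encode (m, r)))) (N f n))"
proof -
  obtain a b where ab: "\<And>f n. eval f a n (A f n)" "\<And>f n. eval f b n (B f n)"
    using assms unfolding recf_def by blast
  have "eval f (PRec a b) (prod_encode (x, k))
      (rec_nat (A f x) (\<lambda>m r. B f (prod_encode (x, prod_encode (m, r)))) k)" for f x k
    by (induction k) (auto intro: eval.intros ab)
  then have "eval f (PRec a b) n (rec_nat (A f (fst (prod_decode n)))
      (\<lambda>m r. B f (prod_encode (fst (prod_decode n), prod_encode (m, r)))) (snd (prod_decode n)))"
    for f n by (metis prod.collapse prod_decode_inverse)
  then have "recf (\<lambda>f n. rec_nat (A f (fst (prod_decode n)))
      (\<lambda>m r. B f (prod_encode (fst (prod_decode n), prod_encode (m, r)))) (snd (prod_decode n)))"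
    unfolding recf_def by blast
  from recf_comp[OF this recf_pair[OF assms(3,4)]] show ?thesis by simp
qed

lemma recf_pred: "recf F \<Longrightarrow> recf (\<lambda>f n. F f n - Suc 0)"
proof -
  assume F: "recf F"
  have "rec_nat 0 (\<lambda>m r. fst (prod_decode (snd (prod_decode (prod_encode (0, prod_encode (m, r)))))))
    k = k - Suc 0" for k :: nat by (cases k) auto
  with recf_rec[OF recf_const[of 0] recf_fst[OF recf_snd[OF recf_id]] recf_const[of 0] F]
  show ?thesis by simp
qed

lemma recf_if0:
  assumes "recf C" "recf A" "recf B"
  shows "recf (\<lambda>f n. if C f n = 0 then A f n else B f n)"
proof -
  have "rec_nat a (\<lambda>m r. g (fst (prod_decode (prod_encode (x, prod_encode (m, r)))))) k =
    (if k = 0 then a else g x)" for a x k and g :: "nat \<Rightarrow> nat" by (cases k) auto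
  note * = this
  have "recf (\<lambda>f n. B f (fst (prod_decode n)))"
    by (rule recf_comp[OF assms(3) recf_fst[OF recf_id]])
  from recf_rec[OF assms(2) this recf_id assms(1)] show ?thesis
    by (simp only: *)
qed

lemma recf_if:
  assumes "recf A" "recf B" "recf C"
  shows "recf (\<lambda>f n. if C f n = k then A f n else B f n)"
  using assms(3)
proof (induction k arbitrary: C)
  case 0
  show ?case by (rule recf_if0[OF 0 assms(1,2)])
next
  case (Suc k)
  have "(\<lambda>f n. if C f n = Suc k then A f n else B f n) =
    (\<lambda>f n. if C f n = 0 then B f n else if C f n - Suc 0 = k then A f n else B f n)"
    by (intro ext) auto
  moreover have "recf (\<lambda>f n. if C f n = 0 then B f n else if C f n - Suc 0 = k then A f n else B f n)"
    by (rule recf_if0[OF Suc.prems assms(2) Suc.IH[OF recf_pred[OF Suc.prems]]])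
  ultimately show ?case by (simp only:)
qed

lemmas recf_intros = recf_pair recf_fst recf_snd recf_query recf_Suc recf_const recf_id
  recf_pred recf_if

lemma recf_double: "recf (\<lambda>f n. 2 * n)"
proof -
  have "recf (\<lambda>f n. rec_nat 0 (\<lambda>m r. Suc (Suc (snd (prod_decode (snd (prod_decode
    (prod_encode (0, prod_encode (m, r)))))))) ) n)"
    by (rule recf_rec) (intro recf_intros)+
  moreover have "rec_nat 0 (\<lambda>m r. Suc (Suc (snd (prod_decode (snd (prod_decode
    (prod_encode (0, prod_encode (m, r)))))))) ) n = 2 * n" for n :: nat by (induction n) auto
  ultimately show ?thesis by simp
qed

lemma recf_mod2: "recf (\<lambda>f n. n mod 2)"
proof -
  have "recf (\<lambda>f n. rec_nat 0 (\<lambda>m r. if snd (prod_decode (snd (prod_decode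
    (prod_encode (0, prod_encode (m, r)))))) = 0 then 1 else 0) n)"
    by (rule recf_rec) (intro recf_intros)+
  moreover have "rec_nat 0 (\<lambda>m r. if snd (prod_decode (snd (prod_decode
    (prod_encode (0, prod_encode (m, r)))))) = 0 then 1 else 0) n = n mod 2" for n :: nat
    by (induction n) (auto, presburger+)
  ultimately show ?thesis by simp
qed

lemma recf_div2: "recf (\<lambda>f n. n div 2)"
proof -
  let ?B = "\<lambda>f k. let m = fst (prod_decode (snd (prod_decode k)));
      r = snd (prod_decode (snd (prod_decode k))) in if m mod 2 = 0 then r else Suc r"
  have "recf ?B"
    unfolding Let_def by (intro recf_intros recf_comp[OF recf_mod2])
  from recf_rec[OF recf_const[of 0] this recf_const[of 0] recf_id]
  have "recf (\<lambda>f n. rec_nat 0 (\<lambda>m r. if m mod 2 = 0 then r else Suc r) n)" by simp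
  moreover have "rec_nat 0 (\<lambda>m r. if m mod 2 = 0 then r else Suc r) n = n div 2" for n :: nat
    by (induction n) (auto, presburger+)
  ultimately show ?thesis by simp
qed

lemma recf_computes: "recf F \<Longrightarrow> \<exists>e. \<forall>f. computes e f (F f)"
  by (auto simp: recf_def computes_def)

lemma pair_fun_simps [simp]: "\<langle>f, g\<rangle> (2 * n) = f n" "\<langle>f, g\<rangle> (Suc (2 * n)) = g n"
  by (simp_all add: pair_fun_def)

lemma pair_fun_inject [simp]: "\<langle>f, g\<rangle> = \<langle>f', g'\<rangle> \<longleftrightarrow> f = f' \<and> g = g'"
  by (metis ext pair_fun_simps)

lemma ex_left: "\<exists>e. \<forall>f g. computes e \<langle>f, g\<rangle> f"
proof -
  have "recf (\<lambda>f n. f (2 * n))" by (intro recf_query recf_double)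
  from recf_computes[OF this] show ?thesis by (auto simp: computes_def) (metis pair_fun_simps(1))
qed

lemma ex_right: "\<exists>e. \<forall>f g. computes e \<langle>f, g\<rangle> g"
proof -
  have "recf (\<lambda>f n. f (Suc (2 * n)))" by (intro recf_query recf_Suc recf_double)
  from recf_computes[OF this] show ?thesis by (auto simp: computes_def) (metis pair_fun_simps(2))
qed

lemma ex_ident: "\<exists>e. \<forall>f. computes e f f"
  using eval.Query unfolding computes_def by blast

lemma ex_join: "\<exists>j. \<forall>f g h. computes d f g \<longrightarrow> computes e f h \<longrightarrow> computes j f \<langle>g, h\<rangle>"
proof -
  let ?S = "\<lambda>k. if fst (prod_decode k) mod 2 = 0
    then fst (prod_decode (snd (prod_decode k))) else snd (prod_decode (snd (prod_decode k)))"
  have "recf (\<lambda>f n. ?S n)" by (intro recf_intros recf_comp[OF recf_mod2])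
  then obtain s where s: "\<And>f n. eval f s n (?S n)" unfolding recf_def by blast
  obtain i where i: "\<And>f n. eval f i n n" using recf_id unfolding recf_def by blast
  obtain v where v: "\<And>f n. eval f v n (n div 2)" using recf_div2 unfolding recf_def by blast
  let ?j = "PComp s (PPair i (PPair (PComp d v) (PComp e v)))"
  have "computes ?j f \<langle>g, h\<rangle>" if "computes d f g" "computes e f h" for f g h
    unfolding computes_def
  proof
    fix n
    have "eval f (PPair i (PPair (PComp d v) (PComp e v))) n
      (prod_encode (n, prod_encode (g (n div 2), h (n div 2))))"
      using that by (auto intro!: eval.Pair i intro: eval.Comp v simp: computes_def)
    from eval.Comp[OF this s] show "eval f ?j n (\<langle>g, h\<rangle> n)"
      by (cases "n mod 2 = 0") (simp_all add: pair_fun_def even_iff_mod_2_eq_zero)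
  qed
  then show ?thesis by blast
qed

lemma weihrauch_le_refl: "F \<le>\<^sub>W F"
proof -
  obtain i where i: "\<And>f. computes i f f" using ex_ident by blast
  obtain r where r: "\<And>f g. computes r \<langle>f, g\<rangle> g" using ex_right by blast
  show ?thesis by (rule weihrauch_leI[where d = i and e = r]) (use i r in blast)
qed

lemma weihrauch_le_trans:
  assumes "F \<le>\<^sub>W G" "G \<le>\<^sub>W H"
  shows "F \<le>\<^sub>W H"
proof -
  obtain d e where de: "\<And>f. f \<in> pdom F \<Longrightarrow> \<exists>x \<in> pdom G. computes d f x \<and>
    (\<forall>g \<in> G x. \<exists>y \<in> F f. computes e \<langle>f, g\<rangle> y)" using weihrauch_leE[OF assms(1)] by blast
  obtain d' e' where de': "\<And>f. f \<in> pdom G \<Longrightarrow> \<exists>x \<in> pdom H. computes d' f x \<and>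
    (\<forall>g \<in> H x. \<exists>y \<in> G f. computes e' \<langle>f, g\<rangle> y)" using weihrauch_leE[OF assms(2)] by blast
  obtain l where l: "\<And>f g. computes l \<langle>f, g\<rangle> f" using ex_left by blast
  obtain r where r: "\<And>f g. computes r \<langle>f, g\<rangle> g" using ex_right by blast
  obtain j where j: "\<And>f g h. computes (psubst l d) f g \<Longrightarrow> computes r f h \<Longrightarrow> computes j f \<langle>g, h\<rangle>"
    using ex_join by blast
  obtain k where k: "\<And>f g h. computes l f g \<Longrightarrow> computes (psubst j e') f h \<Longrightarrow> computes k f \<langle>g, h\<rangle>"
    using ex_join by blast
  show ?thesis
  proof (rule weihrauch_leI[where d = "psubst d d'" and e = "psubst k e"])
    fix f assume "f \<in> pdom F"
    then obtain x where x: "x \<in> pdom G" "computes d f x"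
      "\<And>g. g \<in> G x \<Longrightarrow> \<exists>y \<in> F f. computes e \<langle>f, g\<rangle> y" using de by blast
    obtain z where z: "z \<in> pdom H" "computes d' x z"
      "\<And>g. g \<in> H z \<Longrightarrow> \<exists>y \<in> G x. computes e' \<langle>x, g\<rangle> y" using de'[OF x(1)] by blast
    have "\<exists>y \<in> F f. computes (psubst k e) \<langle>f, g\<rangle> y" if g: "g \<in> H z" for g
    proof -
      obtain y where y: "y \<in> G x" "computes e' \<langle>x, g\<rangle> y" using z(3) g by blast
      obtain w where w: "w \<in> F f" "computes e \<langle>f, y\<rangle> w" using x(3) y(1) by blast
      have "computes j \<langle>f, g\<rangle> \<langle>x, g\<rangle>" by (intro j computes_psubst[OF l x(2)] r)
      then have "computes k \<langle>f, g\<rangle> \<langle>f, y\<rangle>" by (intro k l computes_psubst[OF _ y(2)])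
      with w show ?thesis using computes_psubst by blast
    qed
    with z(1) computes_psubst[OF x(2) z(2)]
    show "\<exists>x \<in> pdom H. computes (psubst d d') f x \<and>
      (\<forall>g \<in> H x. \<exists>y \<in> F f. computes (psubst k e) \<langle>f, g\<rangle> y)" by blast
  qed
qed


section \<open>A universal program\<close>

fun penc :: "prog \<Rightarrow> nat" where
  "penc PZero = prod_encode (0, 0)"
| "penc PSucc = prod_encode (1, 0)"
| "penc PFst = prod_encode (2, 0)"
| "penc PSnd = prod_encode (3, 0)"
| "penc PQuery = prod_encode (4, 0)"
| "penc (PPair a b) = prod_encode (5, prod_encode (penc a, penc b))"
| "penc (PComp a b) = prod_encode (6, prod_encode (penc a, penc b))"
| "penc (PRec a b) = prod_encode (7, prod_encode (penc a, penc b))"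
| "penc (PMu a) = prod_encode (8, penc a)"

lemma penc_inject: "penc a = penc b \<Longrightarrow> a = b"
proof (induction a arbitrary: b)
  case PZero then show ?case by (cases b) auto
next
  case PSucc then show ?case by (cases b) auto
next
  case PFst then show ?case by (cases b) auto
next
  case PSnd then show ?case by (cases b) auto
next
  case PQuery then show ?case by (cases b) auto
next
  case (PPair a1 a2) then show ?case by (cases b) auto
next
  case (PComp a1 a2) then show ?case by (cases b) auto
next
  case (PRec a1 a2) then show ?case by (cases b) auto
next
  case (PMu a) then show ?case by (cases b) auto
qed

text \<open>A stack machine: \<open>evs c n K\<close> is about to evaluate the program coded by \<open>c\<close> at \<open>n\<close>,
  \<open>rets y K\<close> returns \<open>y\<close> to the top frame of the stack \<open>K\<close>.\<close>

abbreviation "fs n \<equiv> fst (prod_decode n)"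
abbreviation "sn n \<equiv> snd (prod_decode n)"
abbreviation "evs c n K \<equiv> prod_encode (0, prod_encode (prod_encode (c, n), K))"
abbreviation "rets y K \<equiv> prod_encode (Suc 0, prod_encode (y, K))"
abbreviation "push t d K \<equiv> Suc (prod_encode (prod_encode (t, d), K))"

definition ev_step :: "baire \<Rightarrow> nat \<Rightarrow> nat \<Rightarrow> nat \<Rightarrow> nat" where
  "ev_step f c n K =
    (if fs c = 0 then rets 0 K
     else if fs c = 1 then rets (Suc n) K
     else if fs c = 2 then rets (fs n) K
     else if fs c = 3 then rets (sn n) K
     else if fs c = 4 then rets (f n) K
     else if fs c = 5 then evs (fs (sn c)) n (push 0 (prod_encode (sn (sn c), n)) K)
     else if fs c = 6 then evs (sn (sn c)) n (push 2 (fs (sn c)) K)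
     else if fs c = 7 then
       (if sn n = 0 then evs (fs (sn c)) (fs n) K
        else evs c (prod_encode (fs n, sn n - Suc 0))
          (push 3 (prod_encode (sn (sn c), prod_encode (fs n, sn n - Suc 0))) K))
     else evs (sn c) (prod_encode (n, 0)) (push 4 (prod_encode (sn c, prod_encode (n, 0))) K))"

definition ret_step :: "nat \<Rightarrow> nat \<Rightarrow> nat \<Rightarrow> nat \<Rightarrow> nat" where
  "ret_step y t d K =
    (if t = 0 then evs (fs d) (sn d) (push 1 y K)
     else if t = 1 then rets (prod_encode (d, y)) K
     else if t = 2 then evs d y K
     else if t = 3 then evs (fs d) (prod_encode (fs (sn d), prod_encode (sn (sn d), y))) K
     else if y = 0 then rets (sn (sn d)) K
     else evs (fs d) (prod_encode (fs (sn d), Suc (sn (sn d))))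
       (push 4 (prod_encode (fs d, prod_encode (fs (sn d), Suc (sn (sn d))))) K))"

definition mstep :: "baire \<Rightarrow> nat \<Rightarrow> nat" where
  "mstep f s =
    (if fs s = 0 then ev_step f (fs (fs (sn s))) (sn (fs (sn s))) (sn (sn s))
     else if sn (sn s) = 0 then s
     else ret_step (fs (sn s)) (fs (fs (sn (sn s) - Suc 0))) (sn (fs (sn (sn s) - Suc 0)))
       (sn (sn (sn s) - Suc 0)))"

lemma recf_mstep: "recf mstep"
  unfolding mstep_def ev_step_def ret_step_def by (intro recf_intros)

definition reaches :: "baire \<Rightarrow> nat \<Rightarrow> nat \<Rightarrow> bool" where
  "reaches f s s' \<longleftrightarrow> (\<exists>t. (mstep f ^^ t) s = s')"

lemma reaches_refl: "reaches f s s"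
  unfolding reaches_def by (rule exI[of _ 0]) simp

lemma reaches_trans: "reaches f s s' \<Longrightarrow> reaches f s' s'' \<Longrightarrow> reaches f s s''"
  unfolding reaches_def by (metis comp_apply funpow_add)

lemma reaches_step: "reaches f (mstep f s) s' \<Longrightarrow> reaches f s s'"
  unfolding reaches_def by (metis comp_apply funpow_Suc_right)

lemma eval_reaches: "eval f e n y \<Longrightarrow> reaches f (evs (penc e) n K) (rets y K)"
proof (induction arbitrary: K rule: eval.induct)
  case (Pair a n x b y)
  show ?case
    apply (rule reaches_step, simp add: mstep_def ev_step_def)
    apply (rule reaches_trans[OF Pair.IH(1)])
    apply (rule reaches_step, simp add: mstep_def ret_step_def)
    apply (rule reaches_trans[OF Pair.IH(2)])
    apply (rule reaches_step, simp add: mstep_def ret_step_def)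
    by (rule reaches_refl)
next
  case (Comp b n x a y)
  show ?case
    apply (rule reaches_step, simp add: mstep_def ev_step_def)
    apply (rule reaches_trans[OF Comp.IH(1)])
    apply (rule reaches_step, simp add: mstep_def ret_step_def)
    by (rule Comp.IH(2))
next
  case (Rec_0 a x y b)
  show ?case
    by (rule reaches_step, simp add: mstep_def ev_step_def) (rule Rec_0.IH)
next
  case (Rec_Suc a b x m r y)
  show ?case
    apply (rule reaches_step, simp add: mstep_def ev_step_def)
    apply (rule reaches_trans[OF Rec_Suc.IH(1)[simplified]])
    apply (rule reaches_step, simp add: mstep_def ret_step_def)
    by (rule Rec_Suc.IH(2))
next
  case (Mu a n k)
  let ?s = "\<lambda>i. evs (penc a) (prod_encode (n, i))
    (push 4 (prod_encode (penc a, prod_encode (n, i))) K)"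
  have *: "reaches f (?s 0) (?s i)" if "i \<le> k" for i
    using that
  proof (induction i)
    case 0
    show ?case by (rule reaches_refl)
  next
    case (Suc i)
    obtain w where "\<And>K. reaches f (evs (penc a) (prod_encode (n, i)) K) (rets (Suc w) K)"
      using Mu.IH(2)[of i] Suc.prems by auto
    note w = this
    show ?case
      apply (rule reaches_trans[OF Suc.IH])
      using Suc.prems apply simp
      apply (rule reaches_trans[OF w])
      apply (rule reaches_step, simp add: mstep_def ret_step_def)
      by (rule reaches_refl)
  qed
  show ?case
    apply (rule reaches_step, simp add: mstep_def ev_step_def)
    apply (rule reaches_trans[OF *[of k]], simp)
    apply (rule reaches_trans[OF Mu.IH(1)])
    apply (rule reaches_step, simp add: mstep_def ret_step_def)
    by (rule reaches_refl)
qed (rule reaches_step, simp add: mstep_def ev_step_def reaches_refl)+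

lemma ex_universal: "\<exists>u. \<forall>f e n y. eval f e n y \<longrightarrow> eval f u (prod_encode (penc e, n)) y"
proof -
  let ?it = "\<lambda>f x t. (mstep f ^^ t) (evs (fs x) (sn x) 0)"
  have it: "rec_nat (evs (fs x) (sn x) 0) (\<lambda>m r. mstep f (sn (sn (prod_encode (x, prod_encode (m, r)))))) t
    = ?it f x t" for f x t by (induction t) auto
  have "recf (\<lambda>f n. rec_nat (evs (fs (fs n)) (sn (fs n)) 0)
      (\<lambda>m r. mstep f (sn (sn (prod_encode (fs n, prod_encode (m, r)))))) (sn n))"
    by (rule recf_rec) (intro recf_intros recf_comp[OF recf_mstep])+
  then have it': "recf (\<lambda>f n. ?it f (fs n) (sn n))" unfolding it .
  let ?h = "\<lambda>f n. if fs (?it f (fs n) (sn n)) = 0 then 1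
    else if sn (sn (?it f (fs n) (sn n))) = 0 then 0 else 1 :: nat"
  have "recf ?h" by (intro recf_intros it')
  then obtain h where h: "\<And>f n. eval f h n (?h f n)" unfolding recf_def by blast
  have "recf (\<lambda>f n. fs (sn (?it f (fs n) (sn n))))" by (intro recf_intros it')
  then obtain g where g: "\<And>f n. eval f g n (fs (sn (?it f (fs n) (sn n))))"
    unfolding recf_def by blast
  obtain i where i: "\<And>f n. eval f i n n" using recf_id unfolding recf_def by blast
  let ?u = "PComp g (PPair i (PMu h))"
  have "eval f ?u x y" if e: "eval f e n y" and x: "x = prod_encode (penc e, n)" for f e n y x
  proof -
    obtain t where t: "?it f x t = rets y 0"
      using eval_reaches[OF e, of 0] x unfolding reaches_def by auto
    define v where "v = ?h f"
    have v: "v n = 0 \<or> v n = Suc 0" for n by (simp add: v_def)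
    have hv: "eval f h n (v n)" for n unfolding v_def by (rule h)
    define P where "P = (\<lambda>t. v (prod_encode (x, t)) = 0)"
    define k where "k = (LEAST t. P t)"
    have "P t" by (simp only: P_def v_def prod_encode_inverse fst_conv snd_conv t) simp
    then have "P k" "k \<le> t" unfolding k_def by (auto intro: LeastI Least_le)
    have fixed: "mstep f (?it f x k) = ?it f x k"
      using \<open>P k\<close> by (auto simp: P_def v_def mstep_def split: if_splits)
    have "(mstep f ^^ m) (?it f x k) = ?it f x k" for m
      by (induction m) (simp_all only: funpow.simps id_apply comp_apply fixed)
    from this[of "t - k"] \<open>k \<le> t\<close> have "?it f x k = rets y 0"
      using t by (metis comp_apply funpow_add le_add_diff_inverse2)
    moreover have "eval f (PMu h) x k"
    proof (rule eval.Mu)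
      show "eval f h (prod_encode (x, k)) 0" using hv[of "prod_encode (x, k)"] \<open>P k\<close>
        by (simp add: P_def)
      fix j assume "j < k"
      then have "\<not> P j" using not_less_Least[of j P] by (simp only: k_def not_False_eq_True)
      then have "v (prod_encode (x, j)) = Suc 0" using v[of "prod_encode (x, j)"] by (simp add: P_def)
      then show "\<exists>w. eval f h (prod_encode (x, j)) (Suc w)"
        using hv[of "prod_encode (x, j)"] by auto
    qed
    ultimately show ?thesis
      using eval.Comp[OF eval.Pair[OF i \<open>eval f (PMu h) x k\<close>] g]
      by (simp only: prod_encode_inverse fst_conv snd_conv)
  qed
  then show ?thesis by blast
qed


section \<open>Existence of the compositional product\<close>

lemma ex_comp_prod: "\<exists>P. is_comp_prod F G P"
proof -
  define R where "R = (\<lambda>w z. \<exists>e. penc e = w 0 \<and> computes e w z)"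
  have R_det: "z = z'" if "R w z" "R w z'" for w z z'
    using that unfolding R_def by (metis computes_det penc_inject)
  define F0 where "F0 = (\<lambda>w. {\<langle>w, r\<rangle> | r z. R w z \<and> r \<in> F z})"
  define G0 where "G0 = (\<lambda>x. {\<langle>a, q\<rangle> | a p q. x = \<langle>a, p\<rangle> \<and> q \<in> G p \<and>
    (\<forall>q' \<in> G p. \<exists>z \<in> pdom F. R \<langle>a, q'\<rangle> z)})"
  obtain l where l: "\<And>f g. computes l \<langle>f, g\<rangle> f" using ex_left by blast
  obtain r where r: "\<And>f g. computes r \<langle>f, g\<rangle> g" using ex_right by blast
  obtain i where i: "\<And>f. computes i f f" using ex_ident by blast
  have comp: "composable F0 G0"
    unfolding composable_def by (fastforce simp: G0_def F0_def pdom_def)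
  have F0: "F0 \<le>\<^sub>W F"
  proof -
    obtain u where u: "\<And>f e n y. eval f e n y \<Longrightarrow> eval f u (prod_encode (penc e, n)) y"
      using ex_universal by blast
    have "recf (\<lambda>f n. prod_encode (f 0, n))" by (intro recf_intros)
    then obtain v where v: "\<And>f n. eval f v n (prod_encode (f 0, n))" unfolding recf_def by blast
    have uv: "computes (PComp u v) w z" if "R w z" for w z
      using that u eval.Comp[OF v] unfolding R_def computes_def by metis
    show ?thesis
    proof (rule weihrauch_leI[where d = "PComp u v" and e = i])
      fix w assume "w \<in> pdom F0"
      then obtain z where z: "R w z" "z \<in> pdom F" by (auto simp: pdom_def F0_def)
      then show "\<exists>x \<in> pdom F. computes (PComp u v) w x \<and>
          (\<forall>g \<in> F x. \<exists>y \<in> F0 w. computes i \<langle>w, g\<rangle> y)"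
        using uv i by (fastforce simp: F0_def)
    qed
  qed
  have G0: "G0 \<le>\<^sub>W G"
  proof -
    obtain j where j: "\<And>f g h. computes (psubst l l) f g \<Longrightarrow> computes r f h \<Longrightarrow> computes j f \<langle>g, h\<rangle>"
      using ex_join by blast
    show ?thesis
    proof (rule weihrauch_leI[where d = r and e = j])
      fix x assume "x \<in> pdom G0"
      then obtain a p where x: "x = \<langle>a, p\<rangle>" "p \<in> pdom G" and
        *: "\<forall>q' \<in> G p. \<exists>z \<in> pdom F. R \<langle>a, q'\<rangle> z" by (auto simp: pdom_def G0_def)
      have "\<exists>y \<in> G0 x. computes j \<langle>x, q\<rangle> y" if "q \<in> G p" for q
      proof
        show "\<langle>a, q\<rangle> \<in> G0 x" using * that x by (auto simp: G0_def)
        show "computes j \<langle>x, q\<rangle> \<langle>a, q\<rangle>" unfolding x by (intro j r computes_psubst[OF l l])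
      qed
      then show "\<exists>y \<in> pdom G. computes r x y \<and> (\<forall>g \<in> G y. \<exists>y \<in> G0 x. computes j \<langle>x, g\<rangle> y)"
        using x r by blast
    qed
  qed
  have "Q \<le>\<^sub>W F0 \<circ>\<^sub>W G0" if "Q \<in> compositions F G" for Q
  proof -
    from that obtain F1 G1 where Q: "Q = F1 \<circ>\<^sub>W G1" "F1 \<le>\<^sub>W F" "G1 \<le>\<^sub>W G" "composable F1 G1"
      unfolding compositions_def by blast
    obtain d1 e1 where 1: "\<And>f. f \<in> pdom F1 \<Longrightarrow> \<exists>x \<in> pdom F. computes d1 f x \<and>
      (\<forall>g \<in> F x. \<exists>y \<in> F1 f. computes e1 \<langle>f, g\<rangle> y)" using weihrauch_leE[OF Q(2)] by blast
    obtain d2 e2 where 2: "\<And>f. f \<in> pdom G1 \<Longrightarrow> \<exists>x \<in> pdom G. computes d2 f x \<and>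
      (\<forall>g \<in> G x. \<exists>y \<in> G1 f. computes e2 \<langle>f, g\<rangle> y)" using weihrauch_leE[OF Q(3)] by blast
    have "recf (\<lambda>f n. f (Suc n))" by (intro recf_intros)
    from recf_computes[OF this] obtain tl where
      tl: "\<And>k f. computes tl (case_nat k f) f" by (auto simp: computes_def) (metis old.nat.simps(5))
    obtain j where j: "\<And>f g h. computes (psubst l tl) f g \<Longrightarrow> computes r f h \<Longrightarrow> computes j f \<langle>g, h\<rangle>"
      using ex_join by blast
    define e where "e = psubst (psubst j e2) d1"
    have "recf (\<lambda>f n. if n = 0 then penc e else f (n - Suc 0))" by (intro recf_intros)
    from recf_computes[OF this] obtain c where
      "\<And>f. computes c f (\<lambda>n. if n = 0 then penc e else f (n - Suc 0))" by blast
    moreover have "(\<lambda>n. if n = 0 then penc e else f (n - Suc 0)) = case_nat (penc e) f" for f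
      by (auto split: nat.split)
    ultimately have c: "\<And>f. computes c f (case_nat (penc e) f)" by simp
    obtain d where d: "\<And>f g h. computes c f g \<Longrightarrow> computes d2 f h \<Longrightarrow> computes d f \<langle>g, h\<rangle>"
      using ex_join by blast
    obtain b where b: "\<And>f g h. computes (psubst (psubst r l) (psubst j e2)) f g \<Longrightarrow>
        computes (psubst r r) f h \<Longrightarrow> computes b f \<langle>g, h\<rangle>"
      using ex_join by blast
    show ?thesis
    proof (rule weihrauch_leI[where d = d and e = "psubst b e1"])
      fix x assume "x \<in> pdom Q"
      then have x: "x \<in> pdom G1" by (auto simp: Q(1) prob_comp_def pdom_def)
      then obtain p where p: "p \<in> pdom G" "computes d2 x p"
        "\<And>q. q \<in> G p \<Longrightarrow> \<exists>y \<in> G1 x. computes e2 \<langle>x, q\<rangle> y" using 2 by blast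
      let ?a = "case_nat (penc e) x"
      have key: "\<exists>y z. y \<in> G1 x \<and> computes (psubst j e2) \<langle>?a, q\<rangle> y \<and> R \<langle>?a, q\<rangle> z \<and>
          z \<in> pdom F \<and> (\<forall>g \<in> F z. \<exists>y' \<in> F1 y. computes e1 \<langle>y, g\<rangle> y')" if q: "q \<in> G p" for q
      proof -
        obtain y where y: "y \<in> G1 x" "computes e2 \<langle>x, q\<rangle> y" using p(3) q by blast
        then have "y \<in> pdom F1" using Q(4) by (auto simp: composable_def)
        from 1[OF this] obtain z where z: "z \<in> pdom F" "computes d1 y z"
          "\<forall>g \<in> F z. \<exists>y' \<in> F1 y. computes e1 \<langle>y, g\<rangle> y'" by blast
        have "computes j \<langle>?a, q\<rangle> \<langle>x, q\<rangle>" by (intro j r computes_psubst[OF l tl])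
        then have jy: "computes (psubst j e2) \<langle>?a, q\<rangle> y" using y(2) computes_psubst by blast
        then have "computes e \<langle>?a, q\<rangle> z" unfolding e_def using z(2) computes_psubst by blast
        moreover have "penc e = \<langle>?a, q\<rangle> 0" by (simp add: pair_fun_def)
        ultimately have "R \<langle>?a, q\<rangle> z" unfolding R_def by blast
        with y z jy show ?thesis by blast
      qed
      have G0x: "G0 \<langle>?a, p\<rangle> = {\<langle>?a, q\<rangle> | q. q \<in> G p}"
        using key unfolding G0_def by fastforce
      have "\<exists>y \<in> Q x. computes (psubst b e1) \<langle>x, g\<rangle> y" if g: "g \<in> (F0 \<circ>\<^sub>W G0) \<langle>?a, p\<rangle>" for g
      proof -
        from g obtain q s z where q: "q \<in> G p" "g = \<langle>\<langle>?a, q\<rangle>, s\<rangle>" "R \<langle>?a, q\<rangle> z" "s \<in> F z"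
          unfolding prob_comp_def G0x F0_def by blast
        from key[OF q(1)] R_det[OF q(3)] obtain y y' where
          y: "y \<in> G1 x" "computes (psubst j e2) \<langle>?a, q\<rangle> y" "y' \<in> F1 y" "computes e1 \<langle>y, s\<rangle> y'"
          using q(4) by metis
        have "computes b \<langle>x, g\<rangle> \<langle>y, s\<rangle>" unfolding q(2)
          by (intro b computes_psubst[OF computes_psubst[OF r l] y(2)] computes_psubst[OF r r])
        then have "computes (psubst b e1) \<langle>x, g\<rangle> y'" using y(4) computes_psubst by blast
        moreover have "y' \<in> Q x" using y by (auto simp: Q(1) prob_comp_def)
        ultimately show ?thesis by blast
      qed
      moreover have "\<langle>?a, p\<rangle> \<in> pdom (F0 \<circ>\<^sub>W G0)"
      proof -
        obtain q where "q \<in> G p" using p(1) by (auto simp: pdom_def)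
        then have "\<langle>?a, q\<rangle> \<in> G0 \<langle>?a, p\<rangle>" using G0x by blast
        then show ?thesis using comp by (fastforce simp: composable_def pdom_def prob_comp_def)
      qed
      moreover have "computes d x \<langle>?a, p\<rangle>" by (intro d c p(2))
      ultimately show "\<exists>w \<in> pdom (F0 \<circ>\<^sub>W G0). computes d x w \<and>
          (\<forall>g \<in> (F0 \<circ>\<^sub>W G0) w. \<exists>y \<in> Q x. computes (psubst b e1) \<langle>x, g\<rangle> y)" by blast
    qed
  qed
  moreover have "F0 \<circ>\<^sub>W G0 \<in> compositions F G"
    unfolding compositions_def using F0 G0 comp by blast
  ultimately show ?thesis unfolding is_comp_prod_def by blast
qed

theorem comp_prod_is_maximum: "is_comp_prod F G (F \<star>\<^sub>W G)"
  unfolding comp_prod_def using ex_comp_prod by (rule someI_ex)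

end

theory Submission
  imports Defs
begin

text \<open>
  Regard a stable colouring as the graph on \<open>\<omega>\<close> whose edges are the pairs of colour \<open>1\<close>, and let
  \<open>H\<close> be a solution for this graph. By stability a vertex is adjacent either to almost all or to
  almost no numbers; only vertices of the first kind (\<^emph>\<open>large\<close> ones) can have infinite degree in \<open>H\<close>.

  (1) If \<open>H\<close> spans no edge, it is already homogeneous. Otherwise every endpoint of an edge in \<open>H\<close>
  is large, and almost all elements of \<open>H\<close> are such endpoints. One application of \<open>LPO\<close> tells the
  cases apart.

  (2) The vertices having two neighbours in \<open>H\<close> are exactly the large ones. If there is none, all
  of \<open>H\<close> is small; if there is exactly one, its neighbours in \<open>H\<close> are small; if there are two,
  almost all elements of \<open>H\<close> are adjacent to both and hence large. Two applications of \<open>LPO\<close>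
  tell the cases apart.

  In each case \<open>H\<close> has a decidable infinite subset all of whose elements have the same limit
  colour, and this set is thinned greedily to a homogeneous one. The witnessing vertices are never
  searched for: it suffices to look at the neighbours of \<open>y\<close> below \<open>y\<close>, so that all functionals
  are total.
\<close>

section \<open>Decidable relations\<close>

text \<open>The oracle is an argument, so a single program decides the relation for all oracles.
  Bounded formulas in the oracle thereby become Turing functionals.\<close>

definition decf :: "(baire \<Rightarrow> nat \<Rightarrow> bool) \<Rightarrow> bool" where
  "decf P \<longleftrightarrow> recf (\<lambda>f n. if P f n then 1 else 0)"

lemma recf_If:
  assumes "decf P" "recf F" "recf G"
  shows "recf (\<lambda>f n. if P f n then F f n else G f n)"
proof -
  have "recf (\<lambda>f n. if (if P f n then 1 else 0) = (1::nat) then F f n else G f n)"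
    using assms unfolding decf_def by (intro recf_if)
  moreover have "(\<lambda>f n. if (if P f n then 1 else 0) = (1::nat) then F f n else G f n) =
      (\<lambda>f n. if P f n then F f n else G f n)" by (intro ext) simp
  ultimately show ?thesis by (simp only:)
qed

lemma decf_eq_const: "recf F \<Longrightarrow> decf (\<lambda>f n. F f n = k)"
  unfolding decf_def by (intro recf_intros)

lemma decf_not: "decf P \<Longrightarrow> decf (\<lambda>f n. \<not> P f n)"
proof -
  assume "decf P"
  then have "recf (\<lambda>f n. if P f n then 0 else 1)" by (intro recf_If recf_const)
  moreover have "(\<lambda>f n. if P f n then 0 else 1) = (\<lambda>f n. if \<not> P f n then 1 else 0 :: nat)"
    by (intro ext) simp
  ultimately show ?thesis unfolding decf_def by (simp only:)
qed

lemma decf_conj: "decf P \<Longrightarrow> decf Q \<Longrightarrow> decf (\<lambda>f n. P f n \<and> Q f n)"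
proof -
  assume "decf P" "decf Q"
  then have "recf (\<lambda>f n. if P f n then if Q f n then 1 else 0 else 0)"
    by (intro recf_If recf_const)
  moreover have "(\<lambda>f n. if P f n then if Q f n then 1 else 0 else 0) =
      (\<lambda>f n. if P f n \<and> Q f n then 1 else 0 :: nat)" by (intro ext) simp
  ultimately show ?thesis unfolding decf_def by simp
qed

lemma decf_disj: "decf P \<Longrightarrow> decf Q \<Longrightarrow> decf (\<lambda>f n. P f n \<or> Q f n)"
  using decf_not[OF decf_conj[OF decf_not decf_not, of P Q]] by simp

lemma decf_imp: "decf P \<Longrightarrow> decf Q \<Longrightarrow> decf (\<lambda>f n. P f n \<longrightarrow> Q f n)"
  unfolding imp_conv_disj by (intro decf_disj decf_not)

lemma decf_iff: "decf P \<Longrightarrow> decf Q \<Longrightarrow> decf (\<lambda>f n. P f n = Q f n)"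
  unfolding iff_conv_conj_imp by (intro decf_conj decf_imp)

lemma decf_comp: "decf P \<Longrightarrow> recf F \<Longrightarrow> decf (\<lambda>f n. P f (F f n))"
  unfolding decf_def by (rule recf_comp[of "\<lambda>f n. if P f n then 1 else 0"])

text \<open>Truncated subtraction is iterated predecessor. Testing it against 0 makes the order
  decidable, and then inequality.\<close>

lemma recf_diff:
  assumes "recf F" "recf G"
  shows "recf (\<lambda>f n. F f n - G f n)"
proof -
  have "rec_nat a (\<lambda>m r. sn (sn (prod_encode (a, prod_encode (m, r)))) - Suc 0) k = a - k"
    for a k :: nat by (induction k) auto
  moreover have "recf (\<lambda>f k. sn (sn k) - Suc 0)" by (intro recf_intros)
  from recf_rec[OF recf_id this assms]
  have "recf (\<lambda>f n. rec_nat (F f n)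
    (\<lambda>m r. sn (sn (prod_encode (F f n, prod_encode (m, r)))) - Suc 0) (G f n))" .
  ultimately show ?thesis by (simp only:)
qed

lemma decf_less: "recf F \<Longrightarrow> recf G \<Longrightarrow> decf (\<lambda>f n. F f n < G f n)"
  using decf_not[OF decf_eq_const[OF recf_diff[of G F], of 0]] by (simp add: not_le)

lemma decf_neq: "recf F \<Longrightarrow> recf G \<Longrightarrow> decf (\<lambda>f n. F f n \<noteq> G f n)"
  unfolding neq_iff by (intro decf_disj decf_less)

text \<open>Primitive recursion on the bound carries a flag that is set to 1 by any witness. As
  programs are unary, the relation between parameter and witness is given on codes of pairs.\<close>

lemma decf_bex:
  assumes "decf (\<lambda>f k. P f (fs k) (sn k))" "recf N"
  shows "decf (\<lambda>f n. \<exists>x<N f n. P f n x)"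
proof -
  let ?B = "\<lambda>f k. if P f (fs k) (fs (sn k)) then 1 else sn (sn k)"
  have "recf (\<lambda>f k. prod_encode (fs k, fs (sn k)))" by (intro recf_intros)
  from decf_comp[OF assms(1) this] have "recf ?B" by (intro recf_If recf_intros) simp
  from recf_rec[OF recf_const[of 0] this recf_id assms(2)]
  have "recf (\<lambda>f n. rec_nat 0 (\<lambda>m r. if P f n m then 1 else r) (N f n))"
    by (simp cong: if_cong)
  moreover have "rec_nat 0 (\<lambda>m r. if P f n m then 1 else r) k = (if \<exists>x<k. P f n x then 1 else 0 :: nat)"
    for f n k by (induction k) (auto simp: less_Suc_eq)
  ultimately show ?thesis unfolding decf_def by (simp only:)
qed

lemma decf_ball:
  assumes "decf (\<lambda>f k. P f (fs k) (sn k))" "recf N"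
  shows "decf (\<lambda>f n. \<forall>x<N f n. P f n x)"
  using decf_not[OF decf_bex[OF decf_not[OF assms(1)] assms(2)]] by simp

lemma recf_double': "recf F \<Longrightarrow> recf (\<lambda>f n. 2 * F f n)"
  by (rule recf_comp[OF recf_double])

text \<open>On a list coded by nested pairs, with head \<open>fs s\<close> and tail
  \<open>sn s\<close>, this drops entries; it gives access to earlier values in a course-of-values
  recursion.\<close>

lemma recf_funpow_sn:
  assumes "recf K" "recf S"
  shows "recf (\<lambda>f n. (sn ^^ K f n) (S f n))"
proof -
  have "recf (\<lambda>f k. sn (sn (sn k)))" by (intro recf_intros)
  from recf_rec[OF recf_id this assms(2,1)]
  have "recf (\<lambda>f n. rec_nat (S f n) (\<lambda>m r. sn r) (K f n))" by simp
  moreover have "rec_nat s (\<lambda>m r. sn r) k = (sn ^^ k) s" for s k by (induction k) auto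
  ultimately show ?thesis by (simp only:)
qed

lemmas decf_intros = decf_not decf_conj decf_disj decf_imp decf_iff decf_less decf_neq decf_bex
  decf_ball decf_eq_const recf_double' recf_pair recf_fst recf_snd recf_query recf_Suc recf_const
  recf_id

section \<open>Greedy thinning\<close>

text \<open>The recursion consults only smaller numbers and never searches for the next member, so
  it is total even if the resulting set is finite.\<close>

fun greedy :: "(nat \<Rightarrow> bool) \<Rightarrow> (nat \<Rightarrow> nat \<Rightarrow> bool) \<Rightarrow> nat \<Rightarrow> bool" where
  "greedy A R y \<longleftrightarrow> A y \<and> (\<forall>x<y. greedy A R x \<longrightarrow> R x y)"

declare greedy.simps [simp del]

text \<open>Course-of-values recursion: \<open>hist f n\<close> lists the values below \<open>n\<close>, latest first.\<close>

lemma decf_greedy: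
  assumes "decf A" "decf (\<lambda>f k. R f (fs k) (sn k))"
  shows "decf (\<lambda>f. greedy (A f) (R f))"
proof -
  let ?step = "\<lambda>f n s. if A f n \<and> (\<forall>x<n. fs ((sn ^^ (n - Suc x)) s) \<noteq> 0 \<longrightarrow> R f x n)
    then 1 else 0 :: nat"
  define hist where
    "hist = (\<lambda>f. rec_nat 0 (\<lambda>n s. prod_encode (?step f n s, s)))"
  have hist_Suc: "hist f (Suc n) = prod_encode (?step f n (hist f n), hist f n)" for f n
    by (simp add: hist_def)
  have drop: "(sn ^^ k) (hist f (k + m)) = hist f m" for f k m
    by (induction k) (simp_all add: funpow_Suc_right hist_Suc del: funpow.simps(2))
  have step_greedy: "?step f n (hist f n) = (if greedy (A f) (R f) n then 1 else 0)" for f n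
  proof (induction n rule: less_induct)
    case (less n)
    \<comment> \<open>\<open>hist f n\<close> lists the values at n-1, ..., 0. Dropping n-1-x of
      them leaves \<open>hist f (Suc x)\<close>, whose head is the value at x.\<close>
    have "fs ((sn ^^ (n - Suc x)) (hist f n)) = (if greedy (A f) (R f) x then 1 else 0)"
      if "x < n" for x
    proof -
      have "(sn ^^ (n - Suc x)) (hist f n) = hist f (Suc x)"
        using drop[of "n - Suc x" f "Suc x"] that by simp
      then show ?thesis using less[OF that] unfolding hist_Suc by simp
    qed
    then have "(\<forall>x<n. fs ((sn ^^ (n - Suc x)) (hist f n)) \<noteq> 0 \<longrightarrow> R f x n) \<longleftrightarrow>
        (\<forall>x<n. greedy (A f) (R f) x \<longrightarrow> R f x n)" by auto
    then show ?case by (simp only: greedy.simps[of "A f" "R f" n])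
  qed
  have A: "recf F \<Longrightarrow> decf (\<lambda>f k. A f (F f k))" for F by (rule decf_comp[OF assms(1)])
  have R: "decf (\<lambda>f k. R f (F f k) (G f k))" if "recf F" "recf G" for F G
    using decf_comp[OF assms(2) recf_pair[OF that]] by simp
  have "recf (\<lambda>f k. prod_encode (?step f (fs (sn k)) (sn (sn k)), sn (sn k)))"
    by (intro recf_pair recf_If A R recf_funpow_sn recf_diff decf_intros)
  from recf_rec[OF recf_const[of 0] this recf_const[of 0] recf_Suc[OF recf_id]]
  have "recf (\<lambda>f n. hist f (Suc n))" unfolding hist_def by simp
  then have "recf (\<lambda>f n. fs (hist f (Suc n)))" by (rule recf_fst)
  then show ?thesis unfolding hist_Suc step_greedy decf_def by simp
qed

lemma greedy_imp: "greedy A R x \<Longrightarrow> A x"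
  unfolding greedy.simps[of A R x] by (rule conjunct1)

lemma greedy_related: "greedy A R x \<Longrightarrow> greedy A R y \<Longrightarrow> x < y \<Longrightarrow> R x y"
  unfolding greedy.simps[of A R y] by blast

text \<open>If only finitely many numbers were accepted, all of them would be related to, and
  smaller than, every sufficiently late y. A late y in \<open>A\<close> would then be accepted and
  be smaller than itself.\<close>

lemma infinite_greedy:
  assumes "infinite {y. A y}" and "\<And>x. A x \<Longrightarrow> \<forall>\<^sub>F y in sequentially. R x y"
  shows "infinite {y. greedy A R y}"
proof
  assume fin: "finite {y. greedy A R y}"
  have "\<forall>x\<in>{y. greedy A R y}. \<forall>\<^sub>F y in sequentially. R x y \<and> x < y"
    using assms(2) greedy_imp by (auto intro!: eventually_conj eventually_gt_at_top)
  then have "\<forall>\<^sub>F y in sequentially. \<forall>x\<in>{y. greedy A R y}. R x y \<and> x < y"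
    by (rule eventually_ball_finite[OF fin])
  then obtain N where N: "\<And>x y. y \<ge> N \<Longrightarrow> greedy A R x \<Longrightarrow> R x y \<and> x < y"
    unfolding eventually_sequentially by blast
  obtain y where "y \<ge> N" "A y" using assms(1) unfolding infinite_nat_iff_unbounded_le by blast
  then have "greedy A R y" using N by (subst greedy.simps) blast
  then show False using N[OF \<open>y \<ge> N\<close>] by blast
qed

section \<open>Reductions to compositional products\<close>

text \<open>The compositional product lies above every admissible composition, so one composition
  above \<open>H\<close> suffices. Both factors copy their input into their output, so that the
  final output contains p, q and r and \<open>\<Psi>\<close> can work from it alone.\<close>

lemma weihrauch_le_comp_prodI:
  assumes rec: "recf \<Phi>" "recf \<Theta>" "recf \<Psi>"
    and \<Phi>: "\<And>p. p \<in> pdom H \<Longrightarrow> \<Phi> p \<in> pdom G"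
    and \<Theta>: "\<And>p q. p \<in> pdom H \<Longrightarrow> q \<in> G (\<Phi> p) \<Longrightarrow> \<Theta> \<langle>p, q\<rangle> \<in> pdom F"
    and \<Psi>: "\<And>p q r. p \<in> pdom H \<Longrightarrow> q \<in> G (\<Phi> p) \<Longrightarrow> r \<in> F (\<Theta> \<langle>p, q\<rangle>) \<Longrightarrow> \<Psi> \<langle>\<langle>p, q\<rangle>, r\<rangle> \<in> H p"
  shows "H \<le>\<^sub>W F \<star>\<^sub>W G"
proof -
  obtain d where d: "\<And>f. computes d f (\<Phi> f)" using recf_computes[OF rec(1)] by blast
  obtain t where t: "\<And>f. computes t f (\<Theta> f)" using recf_computes[OF rec(2)] by blast
  obtain e where e: "\<And>f. computes e f (\<Psi> f)" using recf_computes[OF rec(3)] by blast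
  obtain i where i: "\<And>f. computes i f f" using ex_ident by blast
  obtain r where r: "\<And>f g. computes r \<langle>f, g\<rangle> g" using ex_right by blast
  \<comment> \<open>Composability concerns every output of \<open>G0\<close>, while
    \<open>\<Theta>\<close> is controlled only for p in \<open>pdom H\<close>; hence the restriction
    of the domain.\<close>
  define G0 where "G0 = (\<lambda>p. {\<langle>p, q\<rangle> | q. p \<in> pdom H \<and> q \<in> G (\<Phi> p)})"
  define F0 where "F0 = (\<lambda>w. {\<langle>w, r\<rangle> | r. r \<in> F (\<Theta> w)})"
  have "G0 \<le>\<^sub>W G"
  proof (rule weihrauch_leI[where d = d and e = i])
    fix p assume "p \<in> pdom G0"
    then have p: "p \<in> pdom H" by (auto simp: G0_def pdom_def)
    then have "\<forall>q\<in>G (\<Phi> p). \<langle>p, q\<rangle> \<in> G0 p" by (simp add: G0_def)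
    then show "\<exists>x\<in>pdom G. computes d p x \<and> (\<forall>q\<in>G x. \<exists>y\<in>G0 p. computes i \<langle>p, q\<rangle> y)"
      using \<Phi>[OF p] d i by blast
  qed
  moreover have "F0 \<le>\<^sub>W F"
  proof (rule weihrauch_leI[where d = t and e = i])
    fix w assume "w \<in> pdom F0"
    then have "\<Theta> w \<in> pdom F" by (auto simp: F0_def pdom_def)
    moreover have "\<forall>r\<in>F (\<Theta> w). \<langle>w, r\<rangle> \<in> F0 w" by (simp add: F0_def)
    ultimately show "\<exists>x\<in>pdom F. computes t w x \<and> (\<forall>r\<in>F x. \<exists>y\<in>F0 w. computes i \<langle>w, r\<rangle> y)"
      using t i by blast
  qed
  moreover have comp: "composable F0 G0"
    using \<Theta> unfolding composable_def by (fastforce simp: F0_def G0_def pdom_def)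
  ultimately have "F0 \<circ>\<^sub>W G0 \<in> compositions F G" unfolding compositions_def by blast
  then have "F0 \<circ>\<^sub>W G0 \<le>\<^sub>W F \<star>\<^sub>W G"
    using comp_prod_is_maximum[of F G] unfolding is_comp_prod_def by blast
  moreover have "H \<le>\<^sub>W F0 \<circ>\<^sub>W G0"
  proof (rule weihrauch_leI[where d = i and e = "psubst r e"])
    fix p assume p: "p \<in> pdom H"
    then obtain q where "q \<in> G (\<Phi> p)" using \<Phi> by (fastforce simp: pdom_def)
    then have "\<langle>p, q\<rangle> \<in> G0 p" using p by (auto simp: G0_def)
    then have "p \<in> pdom (F0 \<circ>\<^sub>W G0)"
      using comp by (fastforce simp: composable_def pdom_def prob_comp_def)
    moreover have "\<exists>y\<in>H p. computes (psubst r e) \<langle>p, g\<rangle> y" if "g \<in> (F0 \<circ>\<^sub>W G0) p" for g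
    proof -
      from that have "\<Psi> g \<in> H p" using \<Psi>[OF p] by (auto simp: prob_comp_def F0_def G0_def)
      then show ?thesis using computes_psubst[OF r e] by blast
    qed
    ultimately show "\<exists>x\<in>pdom (F0 \<circ>\<^sub>W G0). computes i p x \<and>
        (\<forall>g\<in>(F0 \<circ>\<^sub>W G0) x. \<exists>y\<in>H p. computes (psubst r e) \<langle>p, g\<rangle> y)"
      using i by blast
  qed
  ultimately show ?thesis using weihrauch_le_trans by blast
qed

section \<open>The graph of a colouring\<close>

text \<open>Adjacency is read off the name, so it is decidable uniformly in p, and it gives a simple
  graph for every p. Only positions coding increasing pairs are consulted, the others being
  irrelevant.\<close>

definition edge :: "baire \<Rightarrow> nat \<Rightarrow> nat \<Rightarrow> bool" where
  "edge p x y \<longleftrightarrow> x < y \<and> p (prod_encode (x, y)) = 1 \<or> y < x \<and> p (prod_encode (y, x)) = 1"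

lemma edge_sym: "edge p x y \<longleftrightarrow> edge p y x"
  by (auto simp: edge_def)

lemma decf_edge:
  assumes "recf P" "recf F" "recf G"
  shows "decf (\<lambda>f n. edge (P f) (F f n) (G f n))"
  unfolding edge_def
  by (intro decf_intros recf_comp[OF assms(1)] assms(2,3))

definition colour_graph :: "baire \<Rightarrow> nat set set" where
  "colour_graph p = {{x, y} | x y. edge p x y}"

lemma mem_colour_graph: "{x, y} \<in> colour_graph p \<longleftrightarrow> edge p x y"
  by (auto simp: colour_graph_def doubleton_eq_iff edge_def)

lemma nbhd_colour_graph: "nbhd (colour_graph p) v = {y. edge p v y}"
  by (simp add: nbhd_def mem_colour_graph)

lemma inf_graph_colour_graph: "inf_graph UNIV (colour_graph p)"
  by (auto simp: inf_graph_def colour_graph_def nsets_def card_2_iff edge_def)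

lemma graph_name_colour_graph:
  "graph_name UNIV (colour_graph p) = \<langle>\<lambda>_. 1, \<lambda>n. if edge p (fs n) (sn n) then 1 else 0\<rangle>"
proof -
  have "n \<in> {prod_encode (u, v) | u v. {u, v} \<in> colour_graph p} \<longleftrightarrow> edge p (fs n) (sn n)" for n
    by (auto simp: mem_colour_graph) (metis prod.collapse prod_decode_inverse)
  then show ?thesis by (simp add: graph_name_def char_fun_def)
qed

lemma recf_graph_name: "recf (\<lambda>p. graph_name UNIV (colour_graph p))"
proof -
  have "recf (\<lambda>f n. if n mod 2 = 0 then 1 else if edge f (fs (n div 2)) (sn (n div 2)) then 1 else 0)"
    by (intro recf_if recf_If decf_edge recf_intros recf_mod2 recf_div2)
  then show ?thesis
    by (simp add: graph_name_colour_graph pair_fun_def even_iff_mod_2_eq_zero cong: if_cong)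
qed

text \<open>A solution is certified by some graph with the given name. The name determines the
  neighbourhoods, so the certificate transfers to the colour graph.\<close>

lemma graph_name_eqD:
  assumes "graph_name V E = graph_name V' E'"
  shows "nbhd E = nbhd E'"
proof -
  have code: "char_fun {prod_encode (u, v) | u v. {u, v} \<in> E} (prod_encode (x, y)) =
    (if {x, y} \<in> E then 1 else 0)" for E x y
    by (auto simp: char_fun_def)
  have "{x, y} \<in> E \<longleftrightarrow> {x, y} \<in> E'" for x y
  proof -
    have "char_fun {prod_encode (u, v) | u v. {u, v} \<in> E} (prod_encode (x, y)) =
        char_fun {prod_encode (u, v) | u v. {u, v} \<in> E'} (prod_encode (x, y))"
      using assms by (simp add: graph_name_def)
    then show ?thesis unfolding code by (simp split: if_splits)
  qed
  then show ?thesis by (auto simp: nbhd_def fun_eq_iff)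
qed

lemma wRSgr_colour_graphD:
  assumes "q \<in> wRSgr (graph_name UNIV (colour_graph p))"
  obtains H where "q = char_fun H" "infinite H"
    "\<And>v. v \<in> H \<Longrightarrow> infinite (H \<inter> {y. edge p v y}) \<or> H \<inter> {y. edge p v y} = {}"
proof -
  from assms obtain H V E where H: "q = char_fun H" "infinite H"
    "\<forall>v\<in>H. infinite (H \<inter> nbhd E v) \<or> H \<inter> nbhd E v = {}"
    and E: "graph_name UNIV (colour_graph p) = graph_name V E"
    unfolding wRSgr_def by blast
  show thesis
    by (rule that[OF H(1,2)])
      (use H(3)[folded graph_name_eqD[OF E], unfolded nbhd_colour_graph] in blast)
qed

lemma wRSg_colour_graphD:
  assumes "q \<in> wRSg (graph_name UNIV (colour_graph p))"
  obtains H where "q = char_fun H" "infinite H"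
    "\<And>v. v \<in> H \<Longrightarrow> infinite (H \<inter> {y. edge p v y}) \<or> card (H \<inter> {y. edge p v y}) \<le> 1"
proof -
  from assms obtain H V E where H: "q = char_fun H" "infinite H"
    "\<forall>v\<in>H. infinite (H \<inter> nbhd E v) \<or> finite (H \<inter> nbhd E v) \<and> card (H \<inter> nbhd E v) \<le> 1"
    and E: "graph_name UNIV (colour_graph p) = graph_name V E"
    unfolding wRSg_def by blast
  show thesis
    by (rule that[OF H(1,2)])
      (use H(3)[folded graph_name_eqD[OF E], unfolded nbhd_colour_graph] in blast)
qed

section \<open>Limit colours: \<open>large\<close> vertices have limit colour 1, the others limit
  colour 0\<close>

definition large :: "baire \<Rightarrow> nat \<Rightarrow> bool" where
  "large p v \<longleftrightarrow> (\<forall>\<^sub>F s in sequentially. edge p v s)"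

lemma edge_names_colouring:
  "names_colouring p c \<Longrightarrow> x < y \<Longrightarrow> edge p x y \<longleftrightarrow> c {x, y} = 1"
  by (simp add: names_colouring_def edge_def)

text \<open>Stability makes adjacency to v eventually constant; if it is not eventually true, it is
  eventually false.\<close>

lemma not_large:
  assumes "p \<in> pdom SRT22" "\<not> large p v"
  shows "\<forall>\<^sub>F s in sequentially. \<not> edge p v s"
proof -
  obtain c where c: "names_colouring p c" "stable_colouring c"
    using assms(1) unfolding pdom_SRT22 by blast
  obtain i where "\<forall>\<^sub>F s in sequentially. c {v, s} = i"
    using c(2) unfolding stable_colouring_def by blast
  then have "\<forall>\<^sub>F s in sequentially. edge p v s \<longleftrightarrow> i = 1"
    using eventually_gt_at_top[of v] by eventually_elim (simp add: edge_names_colouring[OF c(1)])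
  then show ?thesis using assms(2) unfolding large_def by (cases "i = 1") auto
qed

lemma eventually_edge:
  assumes "p \<in> pdom SRT22"
  shows "\<forall>\<^sub>F s in sequentially. edge p v s = large p v"
  using not_large[OF assms, of v] by (cases "large p v") (auto simp: large_def)

lemma infinite_Int_eventually:
  assumes "infinite H" "\<forall>\<^sub>F s in sequentially. P s"
  shows "infinite {s. s \<in> H \<and> P s}"
proof -
  obtain N where N: "\<And>s. s \<ge> N \<Longrightarrow> P s" using assms(2) unfolding eventually_sequentially by blast
  show ?thesis unfolding infinite_nat_iff_unbounded_le
  proof
    fix m
    obtain s where "s \<ge> max m N" "s \<in> H" using assms(1) unfolding infinite_nat_iff_unbounded_le by blast
    then show "\<exists>n\<ge>m. n \<in> {s. s \<in> H \<and> P s}" using N by auto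
  qed
qed

lemma infinite_nbhd_imp_large:
  assumes "p \<in> pdom SRT22" "infinite (H \<inter> {y. edge p v y})"
  shows "large p v"
proof (rule ccontr)
  assume "\<not> large p v"
  from infinite_Int_eventually[OF assms(2) not_large[OF assms(1) this]] show False by simp
qed

text \<open>This leaves only the task of finding an infinite decidable set of vertices with one
  common limit colour. Each of its elements is related to almost all numbers, so
  \<open>infinite_greedy\<close> applies.\<close>

lemma greedy_in_SRT22:
  assumes p: "p \<in> pdom SRT22" and inf: "infinite {y. A y}" and A: "\<And>x. A x \<Longrightarrow> large p x = b"
  shows "char_fun {y. greedy A (\<lambda>x y. edge p x y = b) y} \<in> SRT22 p"
proof -
  let ?B = "{y. greedy A (\<lambda>x y. edge p x y = b) y}"
  obtain c where c: "names_colouring p c" "stable_colouring c"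
    using p unfolding pdom_SRT22 by blast
  have "infinite ?B"
    by (rule infinite_greedy[OF inf], drule A) (use eventually_edge[OF p] in blast)
  moreover have "c e = (if b then 1 else 0)" if e: "e \<in> [?B]\<^bsup>2\<^esup>" for e
  proof -
    from e obtain x y where xy: "e = {x, y}" "x < y" "x \<in> ?B" "y \<in> ?B"
    proof -
      from e obtain u v where uv: "e = {u, v}" "u \<noteq> v" "u \<in> ?B" "v \<in> ?B"
        unfolding nsets_def card_2_iff by blast
      show thesis
      proof (cases "u < v")
        case True
        then show thesis using that uv by blast
      next
        case False
        then show thesis using that[of v u] uv by (simp add: insert_commute)
      qed
    qed
    \<comment> \<open>If \<open>b\<close> is false, non-adjacency only excludes colour 1; the range
      of c then forces colour 0.\<close>
    have "c e \<in> {0, 1}" using c(1) xy by (auto simp: names_colouring_def nsets_def)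
    moreover have "edge p x y = b"
      using greedy_related[of A "\<lambda>x y. edge p x y = b"] xy(2-4) by blast
    ultimately show ?thesis using edge_names_colouring[OF c(1) xy(2)] xy(1) by auto
  qed
  ultimately show ?thesis unfolding SRT22_def using c by blast
qed

section \<open>The two reductions\<close>

lemma char_fun_eq_1 [simp]: "char_fun H x = Suc 0 \<longleftrightarrow> x \<in> H"
  by (simp add: char_fun_def)

lemma pair_fun_0 [simp]: "\<langle>f, g\<rangle> 0 = f 0" "\<langle>f, g\<rangle> (Suc 0) = g 0"
  by (simp_all add: pair_fun_def)

lemma recf_pair_fun: "recf F \<Longrightarrow> recf G \<Longrightarrow> recf (\<lambda>f. \<langle>F f, G f\<rangle>)"
proof -
  assume FG: "recf F" "recf G"
  have "recf (\<lambda>f n. if n mod 2 = 0 then F f (n div 2) else G f (n div 2))"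
    by (intro recf_if recf_mod2 recf_comp[OF FG(1)] recf_comp[OF FG(2)] recf_div2)
  then show ?thesis by (simp add: pair_fun_def even_iff_mod_2_eq_zero)
qed

lemma recf_char: "decf (\<lambda>f. P f) \<Longrightarrow> recf (\<lambda>f. char_fun {y. P f y})"
  unfolding char_fun_def decf_def by simp

lemma LPO_decide:
  assumes "r \<in> LPO (\<lambda>n. if P n then 0 else 1)"
  shows "r 0 = 0 \<longleftrightarrow> (\<exists>n. P n)"
  using assms by (auto simp: LPO_def split: if_splits)

text \<open>With this, one instance of \<open>LPO\<close> can ask for a pair of witnesses.\<close>

lemma ex_prod_decode: "(\<exists>n. P (fs n) (sn n)) \<longleftrightarrow> (\<exists>x y. P x y)"
proof
  assume "\<exists>x y. P x y"
  then obtain x y where "P x y" by blast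
  then have "P (fs (prod_encode (x, y))) (sn (prod_encode (x, y)))" by simp
  then show "\<exists>n. P (fs n) (sn n)" by blast
qed blast

section \<open>The reduction using one application of \<open>LPO\<close>\<close>

lemma SRT22_le_LPO_wRSgr: "SRT22 \<le>\<^sub>W LPO \<star>\<^sub>W wRSgr"
proof -
  define \<Theta> where "\<Theta> = (\<lambda>w. let p = (\<lambda>n. w (2 * n)); q = (\<lambda>n. w (Suc (2 * n))) in
    (\<lambda>n. if q (fs n) = 1 \<and> q (sn n) = 1 \<and> edge p (fs n) (sn n) then 0 else 1 :: nat))"
  \<comment> \<open>Answer b = 0 means that H spans an edge: keep the elements having a smaller
    neighbour in H. Otherwise keep all of H.\<close>
  define A where "A = (\<lambda>p q b y. q y = (1::nat) \<and> (b = (0::nat) \<longrightarrow> (\<exists>x<y. q x = 1 \<and> edge p x y)))"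
  \<comment> \<open>In the pair of the pair of p and q with r, the entry p(n) is at 2(2n), q(n) at
    2(2n+1), and r(0) at 1.\<close>
  define \<Psi> where "\<Psi> = (\<lambda>w. let p = (\<lambda>n. w (2 * (2 * n))); q = (\<lambda>n. w (2 * Suc (2 * n)));
    b = w (Suc 0) in char_fun {y. greedy (A p q b) (\<lambda>x y. edge p x y = (b = 0)) y})"
  show ?thesis
  proof (rule weihrauch_le_comp_prodI)
    show "recf (\<lambda>p. graph_name UNIV (colour_graph p))" by (rule recf_graph_name)
    show "recf \<Theta>" unfolding \<Theta>_def Let_def by (intro recf_If decf_edge decf_intros)
    show "recf \<Psi>" unfolding \<Psi>_def A_def Let_def
      by (intro recf_char decf_greedy decf_edge decf_intros)
  next
    fix p
    show "graph_name UNIV (colour_graph p) \<in> pdom wRSgr"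
      unfolding pdom_wRSgr using inf_graph_colour_graph by blast
  next
    fix p q
    show "\<Theta> \<langle>p, q\<rangle> \<in> pdom LPO" by (simp add: pdom_LPO)
  next
    fix p q r
    assume p: "p \<in> pdom SRT22" and q: "q \<in> wRSgr (graph_name UNIV (colour_graph p))"
      and r: "r \<in> LPO (\<Theta> \<langle>p, q\<rangle>)"
    from q obtain H where H: "q = char_fun H" "infinite H"
      and nbhd: "\<And>v. v \<in> H \<Longrightarrow> infinite (H \<inter> {y. edge p v y}) \<or> H \<inter> {y. edge p v y} = {}"
      by (rule wRSgr_colour_graphD) (rule that)
    \<comment> \<open>A single neighbour in H rules out the empty alternative, so the degree in H is
      infinite.\<close>
    have large: "large p v" if "v \<in> H" "w \<in> H" "edge p v w" for v w
      using nbhd[of v] infinite_nbhd_imp_large[OF p, of H v] that by blast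
    have "r 0 = 0 \<longleftrightarrow> (\<exists>n. q (fs n) = 1 \<and> q (sn n) = 1 \<and> edge p (fs n) (sn n))"
      by (rule LPO_decide) (use r in \<open>simp add: \<Theta>_def cong: if_cong\<close>)
    also have "\<dots> \<longleftrightarrow> (\<exists>u v. q u = 1 \<and> q v = 1 \<and> edge p u v)" by (rule ex_prod_decode)
    finally have r0: "r 0 = 0 \<longleftrightarrow> (\<exists>u v. u \<in> H \<and> v \<in> H \<and> edge p u v)" by (simp add: H(1))
    have \<Psi>: "\<Psi> \<langle>\<langle>p, q\<rangle>, r\<rangle> = char_fun {y. greedy (A p q (r 0)) (\<lambda>x y. edge p x y = (r 0 = 0)) y}"
      unfolding \<Psi>_def Let_def pair_fun_simps by simp
    show "\<Psi> \<langle>\<langle>p, q\<rangle>, r\<rangle> \<in> SRT22 p"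
      unfolding \<Psi>
    proof (rule greedy_in_SRT22[OF p])
      show "infinite {y. A p q (r 0) y}"
      proof (cases "r 0 = 0")
        case True
        then obtain u v where u: "u \<in> H" "v \<in> H" "edge p u v" using r0 by blast
        \<comment> \<open>One large endpoint u of an edge serves as the smaller neighbour of almost
          all y.\<close>
        have "\<forall>\<^sub>F y in sequentially. edge p u y \<and> u < y"
          using large[OF u] unfolding large_def by (intro eventually_conj eventually_gt_at_top)
        from infinite_Int_eventually[OF H(2) this] show ?thesis
          by (rule infinite_super[rotated]) (use u True in \<open>auto simp: A_def H(1)\<close>)
      next
        case False
        then show ?thesis using H by (simp add: A_def)
      qed
      fix x assume x: "A p q (r 0) x"
      then have xH: "x \<in> H" by (simp add: A_def H(1))
      show "large p x = (r 0 = 0)"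
      proof (cases "r 0 = 0")
        case True
        then obtain z where "z \<in> H" "edge p x z" using x edge_sym by (auto simp: A_def H(1))
        then show ?thesis using large[OF xH] True by simp
      next
        case False
        \<comment> \<open>A large vertex would have a neighbour in the infinite set H, but H spans
          no edge.\<close>
        have "\<not> large p x"
        proof
          assume "large p x"
          then have "infinite {y. y \<in> H \<and> edge p x y}"
            unfolding large_def by (rule infinite_Int_eventually[OF H(2)])
          then obtain y where "y \<in> H" "edge p x y" using not_finite_existsD by blast
          then show False using r0 False xH by blast
        qed
        then show ?thesis using False by simp
      qed
    qed
  qed
qed

section \<open>The reduction using two applications of \<open>LPO\<close>\<close>

definition fork :: "baire \<Rightarrow> baire \<Rightarrow> nat \<Rightarrow> nat \<Rightarrow> nat \<Rightarrow> bool" where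
  "fork p q u a b \<longleftrightarrow> q u = 1 \<and> q a = 1 \<and> q b = 1 \<and> a \<noteq> b \<and> edge p u a \<and> edge p u b"

lemma decf_fork:
  assumes "recf P" "recf Q" "recf U" "recf A" "recf B"
  shows "decf (\<lambda>f n. fork (P f) (Q f) (U f n) (A f n) (B f n))"
  unfolding fork_def by (intro decf_intros decf_edge assms recf_comp[OF assms(2)])

text \<open>Two neighbours exceed the bound 1, which leaves infinite degree and hence largeness;
  conversely a large vertex is adjacent to infinitely many elements of H. A fork is thus a finite
  certificate of largeness, and \<open>LPO\<close> can ask whether one exists.\<close>

lemma ex_fork_iff_large:
  assumes p: "p \<in> pdom SRT22" and H: "infinite H" and v: "v \<in> H"
    and nbhd: "infinite (H \<inter> {y. edge p v y}) \<or> card (H \<inter> {y. edge p v y}) \<le> 1"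
  shows "(\<exists>a b. fork p (char_fun H) v a b) \<longleftrightarrow> large p v"
proof
  assume "\<exists>a b. fork p (char_fun H) v a b"
  then obtain a b where ab: "a \<noteq> b" "{a, b} \<subseteq> H \<inter> {y. edge p v y}" by (auto simp: fork_def)
  have "infinite (H \<inter> {y. edge p v y})"
  proof
    assume "finite (H \<inter> {y. edge p v y})"
    then have "card {a, b} \<le> 1" using card_mono[OF _ ab(2)] nbhd by linarith
    then show False using ab(1) by simp
  qed
  then show "large p v" by (rule infinite_nbhd_imp_large[OF p])
next
  assume "large p v"
  then have inf: "infinite {y. y \<in> H \<and> edge p v y}"
    unfolding large_def by (rule infinite_Int_eventually[OF H])
  then obtain a where a: "a \<in> H" "edge p v a" using not_finite_existsD by blast
  from inf obtain b where "b > a" "b \<in> H" "edge p v b"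
    unfolding infinite_nat_iff_unbounded by blast
  then have "fork p (char_fun H) v a b" using a v by (simp add: fork_def)
  then show "\<exists>a b. fork p (char_fun H) v a b" by blast
qed

lemma SRT22_le_LPO_times_LPO_wRSg: "SRT22 \<le>\<^sub>W (LPO \<times>\<^sub>W LPO) \<star>\<^sub>W wRSg"
proof -
  \<comment> \<open>A number n codes a vertex \<open>fs n\<close> with two neighbours certifying
    that it is large. \<open>T2\<close> asks for two such certificates with different
    vertices.\<close>
  define T1 where "T1 = (\<lambda>p q n. fork p q (fs n) (fs (sn n)) (sn (sn n)))"
  define T2 where "T2 = (\<lambda>p q n. fs (fs n) \<noteq> fs (sn n) \<and> T1 p q (fs n) \<and> T1 p q (sn n))"
  define \<Theta> where "\<Theta> = (\<lambda>w. let p = (\<lambda>n. w (2 * n)); q = (\<lambda>n. w (Suc (2 * n))) in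
    \<langle>\<lambda>n. if T1 p q n then 0 else 1, \<lambda>n. if T2 p q n then 0 else 1\<rangle>)"
  \<comment> \<open>With exactly one large vertex x, keep its neighbours y above x that also exceed
    another neighbour z of x. With at least two, keep each y having two smaller neighbours in H.
    With none, keep all of H.\<close>
  define A where "A = (\<lambda>p q b1 b2 y. q y = (1::nat) \<and>
    (b1 = (0::nat) \<and> b2 \<noteq> (0::nat) \<longrightarrow> (\<exists>x<y. \<exists>z<y. fork p q x y z)) \<and>
    (b1 = 0 \<and> b2 = 0 \<longrightarrow> (\<exists>x<y. \<exists>z<y. fork p q y x z)))"
  define \<Psi> where "\<Psi> = (\<lambda>w. let p = (\<lambda>n. w (2 * (2 * n))); q = (\<lambda>n. w (2 * Suc (2 * n)));
    b1 = w (Suc (2 * 0)); b2 = w (Suc (2 * Suc 0)) in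
      char_fun {y. greedy (A p q b1 b2) (\<lambda>x y. edge p x y = (b2 = 0)) y})"
  show ?thesis
  proof (rule weihrauch_le_comp_prodI)
    show "recf (\<lambda>p. graph_name UNIV (colour_graph p))" by (rule recf_graph_name)
    show "recf \<Theta>" unfolding \<Theta>_def T1_def T2_def Let_def
      by (intro recf_pair_fun recf_If decf_fork decf_intros)
    show "recf \<Psi>" unfolding \<Psi>_def A_def Let_def
      by (intro recf_char decf_greedy decf_edge decf_fork decf_intros)
  next
    fix p
    show "graph_name UNIV (colour_graph p) \<in> pdom wRSg"
      unfolding pdom_wRSg using inf_graph_colour_graph by blast
  next
    fix p q
    have "\<langle>f, g\<rangle> \<in> pdom (LPO \<times>\<^sub>W LPO)" for f g
    proof -
      have "f \<in> pdom LPO" "g \<in> pdom LPO" by (simp_all add: pdom_LPO)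
      then show ?thesis by (fastforce simp: pdom_def prob_times_def)
    qed
    then show "\<Theta> \<langle>p, q\<rangle> \<in> pdom (LPO \<times>\<^sub>W LPO)" by (simp add: \<Theta>_def)
  next
    fix p q r
    assume p: "p \<in> pdom SRT22" and q: "q \<in> wRSg (graph_name UNIV (colour_graph p))"
      and r: "r \<in> (LPO \<times>\<^sub>W LPO) (\<Theta> \<langle>p, q\<rangle>)"
    from q obtain H where H: "q = char_fun H" "infinite H"
      and nbhd: "\<And>v. v \<in> H \<Longrightarrow> infinite (H \<inter> {y. edge p v y}) \<or> card (H \<inter> {y. edge p v y}) \<le> 1"
      by (rule wRSg_colour_graphD) (rule that)
    have large: "(\<exists>a b. fork p q v a b) \<longleftrightarrow> large p v" if "v \<in> H" for v
      unfolding H(1) by (rule ex_fork_iff_large[OF p H(2) that nbhd[OF that]])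
    have fork: "fork p q u a b \<longleftrightarrow>
        u \<in> H \<and> a \<in> H \<and> b \<in> H \<and> a \<noteq> b \<and> edge p u a \<and> edge p u b" for u a b
      by (simp add: fork_def H(1))
    from r obtain r1 r2 where r12: "r = \<langle>r1, r2\<rangle>"
      "r1 \<in> LPO (\<lambda>n. if T1 p q n then 0 else 1)" "r2 \<in> LPO (\<lambda>n. if T2 p q n then 0 else 1)"
      by (auto simp: prob_times_def \<Theta>_def cong: if_cong)
    have T1: "(\<exists>n. fs n = u \<and> T1 p q n) \<longleftrightarrow> u \<in> H \<and> large p u" for u
    proof -
      have "(\<exists>n. fs n = u \<and> T1 p q n) \<longleftrightarrow> (\<exists>a b. fork p q u a b)"
        unfolding T1_def by (metis fst_conv snd_conv prod_encode_inverse)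
      then show ?thesis using large fork by blast
    qed
    have b1: "r1 0 = 0 \<longleftrightarrow> (\<exists>u. u \<in> H \<and> large p u)"
      unfolding LPO_decide[OF r12(2)] T1[symmetric] by blast
    have "r2 0 = 0 \<longleftrightarrow> (\<exists>m n. fs m \<noteq> fs n \<and> T1 p q m \<and> T1 p q n)"
      unfolding LPO_decide[OF r12(3)] T2_def by (rule ex_prod_decode)
    also have "\<dots> \<longleftrightarrow> (\<exists>u v. u \<noteq> v \<and> (\<exists>n. fs n = u \<and> T1 p q n) \<and> (\<exists>n. fs n = v \<and> T1 p q n))"
      by blast
    finally have b2: "r2 0 = 0 \<longleftrightarrow> (\<exists>u v. u \<noteq> v \<and> u \<in> H \<and> large p u \<and> v \<in> H \<and> large p v)"
      unfolding T1 by blast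
    have \<Psi>: "\<Psi> \<langle>\<langle>p, q\<rangle>, r\<rangle> =
        char_fun {y. greedy (A p q (r1 0) (r2 0)) (\<lambda>x y. edge p x y = (r2 0 = 0)) y}"
      unfolding \<Psi>_def Let_def pair_fun_simps r12(1) by simp
    have eventually_adj: "\<forall>\<^sub>F y in sequentially. edge p u y \<and> u < y" if "large p u" for u
      using that unfolding large_def by (intro eventually_conj eventually_gt_at_top)
    consider (none) "r1 0 \<noteq> 0" | (one) "r1 0 = 0" "r2 0 \<noteq> 0" | (two) "r1 0 = 0" "r2 0 = 0"
      by blast
    then have "infinite {y. A p q (r1 0) (r2 0) y} \<and>
      (\<forall>x. A p q (r1 0) (r2 0) x \<longrightarrow> large p x = (r2 0 = 0))"
    proof cases
      case none
      then have "A p q (r1 0) (r2 0) = (\<lambda>y. y \<in> H)" by (auto simp: A_def H(1))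
      \<comment> \<open>The colour sought depends on the second answer alone, so that answer must
        also be nonzero when no vertex is large.\<close>
      moreover have "r2 0 \<noteq> 0" using none b1 b2 by auto
      ultimately show ?thesis using none b1 H(2) by auto
    next
      case one
      then have A: "A p q (r1 0) (r2 0) y \<longleftrightarrow> y \<in> H \<and> (\<exists>x<y. \<exists>z<y. fork p q x y z)" for y
        by (auto simp: A_def H(1))
      obtain u where u: "u \<in> H" "large p u" using one b1 by blast
      \<comment> \<open>This fixed neighbour a of u is the third vertex of the fork for almost all
        y.\<close>
      then obtain a where a: "a \<in> H" "edge p u a" using large fork by metis
      have "\<forall>\<^sub>F y in sequentially. (edge p u y \<and> u < y) \<and> a < y"
        by (rule eventually_conj[OF eventually_adj[OF u(2)] eventually_gt_at_top])
      from infinite_Int_eventually[OF H(2) this] have "infinite {y. A p q (r1 0) (r2 0) y}"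
        by (rule infinite_super[rotated]) (use u a in \<open>fastforce simp: A fork\<close>)
      \<comment> \<open>The fork makes x large, and x < y; as there are no two large vertices in H,
        y is not large.\<close>
      moreover have "\<not> large p y" if y: "A p q (r1 0) (r2 0) y" for y
      proof -
        from y obtain x z where "y \<in> H" "x < y" "fork p q x y z" unfolding A by blast
        then have "x \<in> H" "large p x" using fork large by blast+
        then show ?thesis using one b2 \<open>x < y\<close> \<open>y \<in> H\<close> by (metis less_irrefl)
      qed
      ultimately show ?thesis using one by blast
    next
      case two
      then have A: "A p q (r1 0) (r2 0) y \<longleftrightarrow> y \<in> H \<and> (\<exists>x<y. \<exists>z<y. fork p q y x z)" for y
        by (auto simp: A_def H(1))
      obtain u v where uv: "u \<noteq> v" "u \<in> H" "large p u" "v \<in> H" "large p v" using two b2 by blast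
      \<comment> \<open>The two large vertices u and v are the two smaller neighbours of almost all
        y.\<close>
      have "\<forall>\<^sub>F y in sequentially. (edge p u y \<and> u < y) \<and> (edge p v y \<and> v < y)"
        by (rule eventually_conj[OF eventually_adj eventually_adj]) (use uv in blast)+
      from infinite_Int_eventually[OF H(2) this] have "infinite {y. A p q (r1 0) (r2 0) y}"
        by (rule infinite_super[rotated]) (use uv edge_sym in \<open>auto simp: A fork\<close>)
      moreover have "large p y" if "A p q (r1 0) (r2 0) y" for y
        using that large unfolding A by blast
      ultimately show ?thesis using two by blast
    qed
    then show "\<Psi> \<langle>\<langle>p, q\<rangle>, r\<rangle> \<in> SRT22 p"
      unfolding \<Psi> by (intro greedy_in_SRT22[OF p]) blast+
  qed
qed

theorem theorem6p14:
  shows "SRT22 \<le>\<^sub>W LPO \<star>\<^sub>W wRSgr \<and> SRT22 \<le>\<^sub>W (LPO \<times>\<^sub>W LPO) \<star>\<^sub>W wRSg"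
  using SRT22_le_LPO_wRSgr SRT22_le_LPO_times_LPO_wRSg by blast

end
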